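(* For every integer $m$ with $2\le m\le 15$ and every integer $d\ge 1$, the $Z$-polynomial $Z_{U_{m,d}}(t)$ of the uniform matroid $U_{m,d}$ (rank $d$ on $m+d$ elements) has only negative (real) zeros.
   Context: For a loopless matroid $M$ with lattice of flats $L(M)$, characteristic polynomial $\chi_M(t)$ and rank $\operatorname{rk}M$, the Kazhdan–Lusztig polynomial $P_M(t)$ is the unique assignment with $P_M=1$ if $\operatorname{rk}M=0$, $\deg P_M<\frac12\operatorname{rk}M$ if $\operatorname{rk}M>0$, and $t^{\operatorname{rk}M}P_M(t^{-1})=\sum_{F\in L(M)}\chi_{M_F}(t)P_{M^F}(t)$, where $M_F$ is the restriction of $M$ to the flat $F$ and $M^F$ is the contraction of $M$ by $F$. The $Z$-polynomial is $Z_M(t)=\sum_{F\in L(M)}t^{\operatorname{rk}M_F}P_{M^F}(t)$. *)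

theory Defs
  imports Complex_Main "HOL-Computational_Algebra.Polynomial"
begin

record 'a set_system =
  ground :: "'a set"
  indep :: "'a set set"

definition matroid :: "'a set_system \<Rightarrow> bool" where
  "matroid M \<longleftrightarrow>
     finite (ground M) \<and>
     indep M \<subseteq> Pow (ground M) \<and>
     {} \<in> indep M \<and>
     (\<forall>I\<in>indep M. \<forall>J. J \<subseteq> I \<longrightarrow> J \<in> indep M) \<and>
     (\<forall>I\<in>indep M. \<forall>J\<in>indep M. card I < card J \<longrightarrow> (\<exists>x\<in>J - I. insert x I \<in> indep M))"

definition loopless :: "'a set_system \<Rightarrow> bool" where
  "loopless M \<longleftrightarrow> (\<forall>x\<in>ground M. {x} \<in> indep M)"

definition rank_of :: "'a set_system \<Rightarrow> 'a set \<Rightarrow> nat" where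
  "rank_of M A = Max (card ` {I \<in> indep M. I \<subseteq> A})"

definition rk :: "'a set_system \<Rightarrow> nat" where
  "rk M = rank_of M (ground M)"

definition flats :: "'a set_system \<Rightarrow> 'a set set" where
  "flats M = {F. F \<subseteq> ground M \<and> (\<forall>x\<in>ground M - F. rank_of M F < rank_of M (insert x F))}"

definition basis_of :: "'a set_system \<Rightarrow> 'a set \<Rightarrow> 'a set \<Rightarrow> bool" where
  "basis_of M A B \<longleftrightarrow> B \<in> indep M \<and> B \<subseteq> A \<and> (\<forall>I\<in>indep M. B \<subseteq> I \<and> I \<subseteq> A \<longrightarrow> I = B)"

definition restriction :: "'a set_system \<Rightarrow> 'a set \<Rightarrow> 'a set_system" where
  "restriction M A = \<lparr>ground = A, indep = {I \<in> indep M. I \<subseteq> A}\<rparr>"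

definition contraction :: "'a set_system \<Rightarrow> 'a set \<Rightarrow> 'a set_system" where
  "contraction M A =
     \<lparr>ground = ground M - A,
      indep = {I. I \<subseteq> ground M - A \<and> (\<exists>B. basis_of M A B \<and> I \<union> B \<in> indep M)}\<rparr>"

text \<open>The Moebius function of a family \<open>L\<close> of finite sets ordered by inclusion.\<close>

function moebius :: "'a set set \<Rightarrow> 'a set \<Rightarrow> 'a set \<Rightarrow> int" where
  "moebius L F G =
     (if F = G then 1
      else if F \<subset> G \<and> finite G then - (\<Sum>H\<in>{H\<in>L. F \<subseteq> H \<and> H \<subset> G}. moebius L F H)
      else 0)"
  by pat_completeness auto
termination
  by (relation "measure (\<lambda>(L, F, G). card G)") (auto intro: psubset_card_mono)

declare moebius.simps [simp del]

text \<open>For a loopless matroid the least flat is \<open>{}\<close>.\<close>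

definition char_poly :: "'a set_system \<Rightarrow> int poly" where
  "char_poly M = (\<Sum>F\<in>flats M. monom (moebius (flats M) {} F) (rk M - rank_of M F))"

text \<open>\<open>reverse_poly n p\<close> is \<open>t\<^sup>n p(t\<^sup>-\<^sup>1)\<close>, for \<open>degree p \<le> n\<close>.\<close>

definition reverse_poly :: "nat \<Rightarrow> int poly \<Rightarrow> int poly" where
  "reverse_poly n p = (\<Sum>i\<le>n. monom (coeff p i) (n - i))"

lemma coeff_reverse_poly: "coeff (reverse_poly n p) j = (if j \<le> n then coeff p (n - j) else 0)"
proof -
  have "coeff (reverse_poly n p) j = (\<Sum>i\<le>n. if i = n - j \<and> j \<le> n then coeff p i else 0)"
    unfolding reverse_poly_def coeff_sum by (intro sum.cong) auto
  also have "\<dots> = (if j \<le> n then coeff p (n - j) else 0)"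
    by (cases "j \<le> n") (simp_all add: sum.delta)
  finally show ?thesis .
qed

lemma poly_reverse_poly:
  fixes x :: "'b::field_char_0"
  assumes "degree p \<le> n" "x \<noteq> 0"
  shows "poly (map_poly of_int (reverse_poly n p)) x = x ^ n * poly (map_poly of_int p) (inverse x)"
proof -
  have ev: "poly (map_poly of_int q) y = (\<Sum>i\<le>n. of_int (coeff q i) * y ^ i)"
    if "degree q \<le> n" for q :: "int poly" and y :: 'b
    using that by (simp add: poly_altdef coeff_map_poly degree_map_poly)
      (intro sum.mono_neutral_left, auto simp: coeff_eq_0)
  have "degree (reverse_poly n p) \<le> n"
    by (rule degree_le) (simp add: coeff_reverse_poly)
  then have "poly (map_poly of_int (reverse_poly n p)) x = (\<Sum>i\<le>n. of_int (coeff p (n - i)) * x ^ i)"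
    by (simp add: ev coeff_reverse_poly)
  also have "\<dots> = (\<Sum>i\<le>n. of_int (coeff p i) * x ^ (n - i))"
    by (rule sum.reindex_bij_witness[of _ "\<lambda>i. n - i" "\<lambda>i. n - i"]) auto
  also have "\<dots> = (\<Sum>i\<le>n. x ^ n * (of_int (coeff p i) * inverse x ^ i))"
    using assms(2) by (intro sum.cong) (auto simp: power_diff field_simps)
  also have "\<dots> = x ^ n * poly (map_poly of_int p) (inverse x)"
    using assms(1) by (simp add: ev sum_distrib_left)
  finally show ?thesis .
qed

definition kl_assignment :: "('a set_system \<Rightarrow> int poly) \<Rightarrow> bool" where
  "kl_assignment P \<longleftrightarrow>
     (\<forall>M. matroid M \<and> loopless M \<longrightarrow>
        (rk M = 0 \<longrightarrow> P M = 1) \<and>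
        (rk M > 0 \<longrightarrow> 2 * degree (P M) < rk M) \<and>
        reverse_poly (rk M) (P M) =
          (\<Sum>F\<in>flats M. char_poly (restriction M F) * P (contraction M F)))"

text \<open>
  The value \<open>0\<close> off the loopless matroids only serves to make the total function unique.
  That the description is proper is \<open>kl_assignment_kl_poly\<close> and \<open>kl_assignment_unique\<close> below.
\<close>

definition kl_poly :: "'a set_system \<Rightarrow> int poly" where
  "kl_poly = (THE P. kl_assignment P \<and> (\<forall>M. \<not> (matroid M \<and> loopless M) \<longrightarrow> P M = 0))"

definition z_poly :: "'a set_system \<Rightarrow> int poly" where
  "z_poly M = (\<Sum>F\<in>flats M. monom 1 (rk (restriction M F)) * kl_poly (contraction M F))"

definition uniform_matroid :: "'a set \<Rightarrow> nat \<Rightarrow> 'a set_system" where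
  "uniform_matroid E d = \<lparr>ground = E, indep = {I. I \<subseteq> E \<and> card I \<le> d}\<rparr>"

lemma matroidD:
  assumes "matroid M"
  shows "finite (ground M)" "\<And>I. I \<in> indep M \<Longrightarrow> I \<subseteq> ground M" "{} \<in> indep M"
    "\<And>I J. I \<in> indep M \<Longrightarrow> J \<subseteq> I \<Longrightarrow> J \<in> indep M"
    "\<And>I J. I \<in> indep M \<Longrightarrow> J \<in> indep M \<Longrightarrow> card I < card J \<Longrightarrow> \<exists>x\<in>J - I. insert x I \<in> indep M"
    "\<And>I. I \<in> indep M \<Longrightarrow> finite I" "finite (indep M)"
proof -
  show *: "finite (ground M)" and **: "\<And>I. I \<in> indep M \<Longrightarrow> I \<subseteq> ground M" and "{} \<in> indep M"
    and "\<And>I J. I \<in> indep M \<Longrightarrow> J \<subseteq> I \<Longrightarrow> J \<in> indep M"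
    and "\<And>I J. I \<in> indep M \<Longrightarrow> J \<in> indep M \<Longrightarrow> card I < card J \<Longrightarrow> \<exists>x\<in>J - I. insert x I \<in> indep M"
    using assms unfolding matroid_def by blast+
  show "\<And>I. I \<in> indep M \<Longrightarrow> finite I" using * ** finite_subset by blast
  show "finite (indep M)" using * ** by (meson PowI finite_Pow_iff finite_subset subsetI)
qed

lemma card_le_rank_of:
  assumes "matroid M" "I \<in> indep M" "I \<subseteq> A"
  shows "card I \<le> rank_of M A"
  unfolding rank_of_def using assms matroidD(7)[OF assms(1)] by (intro Max_ge) auto

lemma rank_of_attained:
  assumes "matroid M"
  obtains I where "I \<in> indep M" "I \<subseteq> A" "card I = rank_of M A"
proof -
  have "rank_of M A \<in> card ` {I \<in> indep M. I \<subseteq> A}"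
    unfolding rank_of_def using matroidD(3,7)[OF assms] by (intro Max_in) auto
  then show ?thesis using that by auto
qed

lemma basis_of_maximal: "basis_of M A B \<Longrightarrow> I \<in> indep M \<Longrightarrow> B \<subseteq> I \<Longrightarrow> I \<subseteq> A \<Longrightarrow> I = B"
  by (simp add: basis_of_def)

lemma basis_of_card:
  assumes "matroid M" "basis_of M A B"
  shows "card B = rank_of M A"
proof (rule ccontr)
  assume "card B \<noteq> rank_of M A"
  moreover have B: "B \<in> indep M" "B \<subseteq> A" using assms(2) by (auto simp: basis_of_def)
  ultimately have lt: "card B < rank_of M A" using card_le_rank_of[OF assms(1), of B A] by simp
  obtain I where I: "I \<in> indep M" "I \<subseteq> A" "card I = rank_of M A" using rank_of_attained[OF assms(1)] .
  obtain x where "x \<in> I - B" "insert x B \<in> indep M"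
    using matroidD(5)[OF assms(1) B(1) I(1)] lt I(3) by auto
  then show False using assms(2) I(2) B(2) unfolding basis_of_def by blast
qed

lemma basis_ofI:
  assumes "matroid M" "B \<in> indep M" "B \<subseteq> A" "card B = rank_of M A"
  shows "basis_of M A B"
  unfolding basis_of_def
proof (intro conjI ballI impI)
  fix I assume I: "I \<in> indep M" "B \<subseteq> I \<and> I \<subseteq> A"
  then have "card I \<le> card B" using card_le_rank_of[OF assms(1), of I A] assms(4) by simp
  then show "I = B" using I matroidD(6)[OF assms(1)] by (metis card_seteq)
qed (use assms in auto)

lemma basis_of_extend:
  assumes "matroid M" "I \<in> indep M" "I \<subseteq> A"
  obtains B where "basis_of M A B" "I \<subseteq> B"
proof -
  let ?S = "{J \<in> indep M. I \<subseteq> J \<and> J \<subseteq> A}"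
  have fin: "finite ?S" and ne: "I \<in> ?S" using assms matroidD(7)[OF assms(1)] by auto
  then obtain B where B: "B \<in> ?S" "\<And>J. J \<in> ?S \<Longrightarrow> B \<subseteq> J \<Longrightarrow> J = B"
    using finite_has_maximal[of ?S] by (metis (no_types, lifting) empty_iff)
  then show ?thesis using that[of B] unfolding basis_of_def by blast
qed

lemma basis_of_exists:
  assumes "matroid M"
  obtains B where "basis_of M A B"
  using basis_of_extend[OF assms matroidD(3)[OF assms], of A] by auto

lemma rank_of_mono:
  assumes "matroid M" "A \<subseteq> B"
  shows "rank_of M A \<le> rank_of M B"
proof -
  obtain I where "I \<in> indep M" "I \<subseteq> A" "card I = rank_of M A" using rank_of_attained[OF assms(1)] .
  then show ?thesis using card_le_rank_of[OF assms(1), of I B] assms(2) by auto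
qed

lemma rank_of_empty: "matroid M \<Longrightarrow> rank_of M {} = 0"
  by (rule rank_of_attained[of M "{}"]) auto

lemma restriction_simps [simp]:
  "ground (restriction M A) = A" "indep (restriction M A) = {I \<in> indep M. I \<subseteq> A}"
  by (simp_all add: restriction_def)

lemma matroid_restriction:
  assumes "matroid M" "A \<subseteq> ground M"
  shows "matroid (restriction M A)"
  unfolding matroid_def restriction_simps
proof (intro conjI ballI allI impI)
  show "finite A" using assms matroidD(1) finite_subset by blast
  show "{} \<in> {I \<in> indep M. I \<subseteq> A}" using matroidD(3)[OF assms(1)] by simp
next
  fix I J assume IJ: "I \<in> {I \<in> indep M. I \<subseteq> A}" "J \<in> {I \<in> indep M. I \<subseteq> A}" "card I < card J"
  then obtain x where "x \<in> J - I" "insert x I \<in> indep M" using matroidD(5)[OF assms(1), of I J] by auto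
  with IJ show "\<exists>x\<in>J - I. insert x I \<in> {I \<in> indep M. I \<subseteq> A}" by auto
qed (use matroidD(4)[OF assms(1)] in auto)

lemma loopless_restriction: "loopless M \<Longrightarrow> A \<subseteq> ground M \<Longrightarrow> loopless (restriction M A)"
  by (auto simp: loopless_def)

lemma rank_of_restriction: "X \<subseteq> A \<Longrightarrow> rank_of (restriction M A) X = rank_of M X"
  unfolding rank_of_def by (rule arg_cong[where f = "\<lambda>S. Max (card ` S)"]) auto

lemma basis_of_restriction: "X \<subseteq> A \<Longrightarrow> basis_of (restriction M A) X B = basis_of M X B"
  unfolding basis_of_def restriction_simps mem_Collect_eq by (blast intro: subset_trans)

lemma indep_contraction_iff:
  assumes "matroid M" "basis_of M A B"
  shows "I \<in> indep (contraction M A) \<longleftrightarrow> I \<subseteq> ground M - A \<and> I \<union> B \<in> indep M"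
proof
  assume "I \<in> indep (contraction M A)"
  then obtain B' where I: "I \<subseteq> ground M - A" and B': "basis_of M A B'" "I \<union> B' \<in> indep M"
    by (auto simp: contraction_def)
  have B: "B \<in> indep M" "B \<subseteq> A" and B'A: "B' \<subseteq> A" using assms(2) B'(1) by (auto simp: basis_of_def)
  obtain C where C: "basis_of M (I \<union> A) C" "B \<subseteq> C" using basis_of_extend[OF assms(1) B(1), of "I \<union> A"] B(2) by blast
  have Ci: "C \<in> indep M" "C \<subseteq> I \<union> A" using C(1) by (auto simp: basis_of_def)
  have "C \<inter> A \<in> indep M" using matroidD(4)[OF assms(1) Ci(1)] by blast
  then have CA: "C \<inter> A = B" using basis_of_maximal[OF assms(2)] C(2) B(2) by simp
  then have CIB: "C \<subseteq> I \<union> B" using Ci(2) by blast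
  have fin: "finite I" "finite B" "finite B'"
    using matroidD(6)[OF assms(1) B(1)] matroidD(6)[OF assms(1) B'(2)] by auto
  have "card (I \<union> B) = card I + card B" using I B(2) fin by (intro card_Un_disjoint) auto
  also have "\<dots> = card I + card B'" using assms B'(1) by (simp add: basis_of_card)
  also have "\<dots> = card (I \<union> B')" using I B'A fin by (intro card_Un_disjoint[symmetric]) auto
  also have "\<dots> \<le> rank_of M (I \<union> A)" using card_le_rank_of[OF assms(1) B'(2)] B'A by blast
  also have "\<dots> = card C" using C(1) assms(1) by (simp add: basis_of_card)
  finally have "C = I \<union> B" using CIB fin by (metis card_seteq finite_UnI)
  then show "I \<subseteq> ground M - A \<and> I \<union> B \<in> indep M" using I Ci(1) by simp
next
  assume "I \<subseteq> ground M - A \<and> I \<union> B \<in> indep M"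
  then show "I \<in> indep (contraction M A)" using assms(2) by (auto simp: contraction_def)
qed

lemma ground_contraction [simp]: "ground (contraction M A) = ground M - A"
  by (simp add: contraction_def)

lemma matroid_contraction:
  assumes "matroid M"
  shows "matroid (contraction M A)"
proof -
  obtain B where B: "basis_of M A B" using basis_of_exists[OF assms] .
  note iff = indep_contraction_iff[OF assms B]
  have BA: "B \<in> indep M" "B \<subseteq> A" using B by (auto simp: basis_of_def)
  show ?thesis
    unfolding matroid_def
  proof (intro conjI ballI allI impI)
    show "finite (ground (contraction M A))" using matroidD(1)[OF assms] by simp
    show "indep (contraction M A) \<subseteq> Pow (ground (contraction M A))" using iff by auto
    show "{} \<in> indep (contraction M A)" using iff BA by simp
  next
    fix I J assume "I \<in> indep (contraction M A)" "J \<subseteq> I"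
    then show "J \<in> indep (contraction M A)" using iff matroidD(4)[OF assms, of "I \<union> B" "J \<union> B"] by auto
  next
    fix I J assume I: "I \<in> indep (contraction M A)" and J: "J \<in> indep (contraction M A)" and lt: "card I < card J"
    have fin: "finite I" "finite J" "finite B" using I J iff matroidD(6)[OF assms] by (metis finite_Un)+
    have "card (I \<union> B) = card I + card B" using I iff BA fin by (intro card_Un_disjoint) auto
    moreover have "card (J \<union> B) = card J + card B" using J iff BA fin by (intro card_Un_disjoint) auto
    ultimately obtain x where x: "x \<in> (J \<union> B) - (I \<union> B)" "insert x (I \<union> B) \<in> indep M"
      using matroidD(5)[OF assms, of "I \<union> B" "J \<union> B"] I J iff lt by auto
    then have "x \<in> J - I" "insert x I \<in> indep (contraction M A)" using I J iff by auto
    then show "\<exists>x\<in>J - I. insert x I \<in> indep (contraction M A)" by blast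
  qed
qed

lemma rank_of_contraction:
  assumes "matroid M" "X \<subseteq> ground M - A"
  shows "rank_of (contraction M A) X + rank_of M A = rank_of M (X \<union> A)"
proof -
  obtain B where B: "basis_of M A B" using basis_of_exists[OF assms(1)] .
  note iff = indep_contraction_iff[OF assms(1) B]
  have BA: "B \<in> indep M" "B \<subseteq> A" using B by (auto simp: basis_of_def)
  obtain I where I: "I \<in> indep (contraction M A)" "I \<subseteq> X" "card I = rank_of (contraction M A) X"
    using rank_of_attained[OF matroid_contraction[OF assms(1)]] .
  obtain C where C: "basis_of M (X \<union> A) C" "B \<subseteq> C" using basis_of_extend[OF assms(1) BA(1), of "X \<union> A"] BA(2) by blast
  have Ci: "C \<in> indep M" "C \<subseteq> X \<union> A" using C(1) by (auto simp: basis_of_def)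
  have "C \<inter> A \<in> indep M" using matroidD(4)[OF assms(1) Ci(1)] by blast
  then have CA: "C \<inter> A = B" using basis_of_maximal[OF B] C(2) BA(2) by simp
  have fin: "finite I" "finite B" "finite C"
    using I iff matroidD(6)[OF assms(1)] Ci BA by (metis finite_Un)+
  have "C - A \<in> indep (contraction M A)"
  proof -
    have "(C - A) \<union> B = C" using CA by blast
    then show ?thesis using iff Ci(1) matroidD(2)[OF assms(1) Ci(1)] by auto
  qed
  then have "card (C - A) \<le> rank_of (contraction M A) X"
    using card_le_rank_of[OF matroid_contraction[OF assms(1)]] Ci(2) by blast
  moreover have "card C = card (C - A) + card B"
    using CA fin card_Diff_subset_Int[of C A] card_mono[of C B] C(2) by simp
  moreover have "card I + card B = card (I \<union> B)" using I iff BA fin by (intro card_Un_disjoint[symmetric]) auto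
  moreover have "card (I \<union> B) \<le> rank_of M (X \<union> A)"
  proof (rule card_le_rank_of[OF assms(1)])
    show "I \<union> B \<in> indep M" using I(1) iff by simp
    show "I \<union> B \<subseteq> X \<union> A" using I(2) BA(2) by blast
  qed
  ultimately show ?thesis using I(3) basis_of_card[OF assms(1) B] basis_of_card[OF assms(1) C(1)] by linarith
qed

lemma flatsD: "F \<in> flats M \<Longrightarrow> F \<subseteq> ground M"
  by (simp add: flats_def)

lemma finite_flats: "matroid M \<Longrightarrow> finite (flats M)"
  by (rule finite_subset[of _ "Pow (ground M)"]) (auto simp: matroid_def flats_def)

lemma loopless_contraction:
  assumes "matroid M" "F \<in> flats M"
  shows "loopless (contraction M F)"
  unfolding loopless_def
proof
  fix x assume x: "x \<in> ground (contraction M F)"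
  then have "rank_of M F < rank_of M (insert x F)" using assms(2) by (auto simp: flats_def)
  moreover have "rank_of (contraction M F) {x} + rank_of M F = rank_of M (insert x F)"
    using rank_of_contraction[OF assms(1), of "{x}" F] x by auto
  ultimately have "rank_of (contraction M F) {x} > 0" by simp
  moreover obtain I where "I \<in> indep (contraction M F)" "I \<subseteq> {x}" "card I = rank_of (contraction M F) {x}"
    using rank_of_attained[OF matroid_contraction[OF assms(1)]] .
  ultimately show "{x} \<in> indep (contraction M F)" by (cases "I = {}") (auto simp: subset_singleton_iff)
qed

lemma empty_in_flats:
  assumes "matroid M" "loopless M"
  shows "{} \<in> flats M"
proof -
  have "0 < rank_of M {x}" if "x \<in> ground M" for x
    using card_le_rank_of[OF assms(1), of "{x}" "{x}"] assms(2) that by (simp add: loopless_def)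
  then show ?thesis by (simp add: flats_def rank_of_empty[OF assms(1)])
qed

lemma contraction_empty:
  assumes "matroid M"
  shows "contraction M {} = M"
proof -
  have b: "basis_of M {} {}" using matroidD(3)[OF assms] by (auto simp: basis_of_def)
  have "indep (contraction M {}) = indep M"
    using indep_contraction_iff[OF assms b] matroidD(2)[OF assms] by auto
  then show ?thesis by (intro set_system.equality) auto
qed

lemma char_poly_restriction_empty:
  assumes "matroid M"
  shows "char_poly (restriction M {}) = 1"
proof -
  have "flats (restriction M {}) = {{}}" by (auto simp: flats_def)
  then show ?thesis by (simp add: char_poly_def rk_def moebius.simps)
qed

lemma flats_restriction:
  assumes "matroid M" "F \<in> flats M"
  shows "flats (restriction M F) = {G \<in> flats M. G \<subseteq> F}"
proof -
  have F: "F \<subseteq> ground M" using assms(2) flatsD by blast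
  have "rank_of M G < rank_of M (insert x G)"
    if G: "G \<subseteq> F" "\<forall>x\<in>F - G. rank_of M G < rank_of M (insert x G)" and x: "x \<in> ground M - G" for G x
  proof (cases "x \<in> F")
    case False
    obtain I where I: "basis_of M G I" using basis_of_exists[OF assms(1)] .
    then have Ii: "I \<in> indep M" "I \<subseteq> G" by (auto simp: basis_of_def)
    obtain J where J: "basis_of M F J" "I \<subseteq> J" using basis_of_extend[OF assms(1) Ii(1), of F] Ii(2) G(1) by blast
    then have Ji: "J \<in> indep M" "J \<subseteq> F" by (auto simp: basis_of_def)
    have lt: "rank_of M F < rank_of M (insert x F)" using assms(2) False x by (simp add: flats_def)
    obtain K where K: "basis_of M (insert x F) K" "J \<subseteq> K" using basis_of_extend[OF assms(1) Ji(1), of "insert x F"] Ji(2) by blast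
    then have Ki: "K \<in> indep M" "K \<subseteq> insert x F" by (auto simp: basis_of_def)
    have "x \<in> K"
    proof (rule ccontr)
      assume "x \<notin> K"
      then have "K \<subseteq> F" using Ki(2) by blast
      then have "card K \<le> rank_of M F" using card_le_rank_of[OF assms(1) Ki(1)] by blast
      then show False using lt basis_of_card[OF assms(1) K(1)] by simp
    qed
    then have "insert x I \<subseteq> K" using J(2) K(2) by simp
    then have "insert x I \<in> indep M" by (rule matroidD(4)[OF assms(1) Ki(1)])
    then have "card (insert x I) \<le> rank_of M (insert x G)"
      using card_le_rank_of[OF assms(1)] Ii(2) by blast
    moreover have "x \<notin> I" using x Ii(2) by blast
    ultimately show ?thesis using matroidD(6)[OF assms(1) Ii(1)] basis_of_card[OF assms(1) I] by simp
  qed (use that in auto)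
  then have down: "G \<in> flats M"
    if "G \<subseteq> F" "\<forall>x\<in>F - G. rank_of M G < rank_of M (insert x G)" for G
    using that F by (simp add: flats_def)
  have r: "rank_of (restriction M F) G = rank_of M G" if "G \<subseteq> F" for G
    using that by (rule rank_of_restriction)
  show ?thesis
  proof (intro equalityI subsetI)
    fix G assume "G \<in> flats (restriction M F)"
    then have "G \<subseteq> F" "\<forall>x\<in>F - G. rank_of M G < rank_of M (insert x G)"
      using r by (auto simp: flats_def)
    then show "G \<in> {G \<in> flats M. G \<subseteq> F}" using down by simp
  next
    fix G assume "G \<in> {G \<in> flats M. G \<subseteq> F}"
    then show "G \<in> flats (restriction M F)" using r F by (auto simp: flats_def)
  qed
qed

lemma flats_contraction_iff:
  assumes "matroid M" "F \<subseteq> G" "G \<subseteq> ground M"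
  shows "G - F \<in> flats (contraction M F) \<longleftrightarrow> G \<in> flats M"
proof -
  have "rank_of (contraction M F) (G - F) + rank_of M F = rank_of M G"
    using rank_of_contraction[OF assms(1), of "G - F" F] assms by (auto simp: Un_absorb2)
  moreover have "rank_of (contraction M F) (insert x (G - F)) + rank_of M F = rank_of M (insert x G)"
    if "x \<in> ground M - G" for x
  proof -
    have "insert x (G - F) \<union> F = insert x G" using assms(2) by blast
    then show ?thesis using rank_of_contraction[OF assms(1), of "insert x (G - F)" F] assms that by auto
  qed
  moreover have "ground M - F - (G - F) = ground M - G" using assms by blast
  ultimately show ?thesis using assms unfolding flats_def by (auto; metis DiffI add_less_cancel_right)
qed

lemma flats_contraction:
  assumes "matroid M" "F \<in> flats M"
  shows "flats (contraction M F) = (\<lambda>G. G - F) ` {G \<in> flats M. F \<subseteq> G}"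
proof (intro equalityI subsetI)
  fix X assume X: "X \<in> flats (contraction M F)"
  then have "X \<subseteq> ground M - F" using flatsD by fastforce
  then have *: "X = (X \<union> F) - F" "X \<union> F \<subseteq> ground M" using flatsD[OF assms(2)] by auto
  then have "X \<union> F \<in> flats M" using X flats_contraction_iff[OF assms(1), of F "X \<union> F"] by auto
  then show "X \<in> (\<lambda>G. G - F) ` {G \<in> flats M. F \<subseteq> G}" using *(1) by blast
next
  fix X assume "X \<in> (\<lambda>G. G - F) ` {G \<in> flats M. F \<subseteq> G}"
  then show "X \<in> flats (contraction M F)" by (auto simp: flats_contraction_iff[OF assms(1) _ flatsD])
qed

lemma restriction_contraction:
  assumes "F \<subseteq> G" "G \<subseteq> ground M"
  shows "restriction (contraction M F) (G - F) = contraction (restriction M G) F"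
proof -
  have "I \<subseteq> ground M - F \<and> (\<exists>B. basis_of M F B \<and> I \<union> B \<in> indep M) \<and> I \<subseteq> G - F \<longleftrightarrow>
        I \<subseteq> G - F \<and> (\<exists>B. basis_of M F B \<and> I \<union> B \<in> indep M \<and> I \<union> B \<subseteq> G)" for I
  proof -
    have "I \<union> B \<subseteq> G" if "basis_of M F B" "I \<subseteq> G - F" for B
      using that assms by (auto simp: basis_of_def)
    moreover have "I \<subseteq> ground M - F" if "I \<subseteq> G - F" using that assms by blast
    ultimately show ?thesis by metis
  qed
  then show ?thesis
    by (simp add: restriction_def contraction_def basis_of_restriction[OF assms(1), unfolded restriction_def])
qed

lemma contraction_contraction:
  assumes "matroid M" "F \<subseteq> G" "G \<subseteq> ground M"
  shows "contraction (contraction M F) (G - F) = contraction M G"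
proof -
  obtain B where B: "basis_of M F B" using basis_of_exists[OF assms(1)] .
  then have Bi: "B \<in> indep M" "B \<subseteq> F" by (auto simp: basis_of_def)
  obtain C where C: "basis_of M G C" "B \<subseteq> C" using basis_of_extend[OF assms(1) Bi(1), of G] Bi(2) assms(2) by blast
  have Ci: "C \<in> indep M" "C \<subseteq> G" using C(1) by (auto simp: basis_of_def)
  have "C \<inter> F \<in> indep M" using matroidD(4)[OF assms(1) Ci(1)] by blast
  then have CF: "C \<inter> F = B" using basis_of_maximal[OF B] C(2) Bi(2) by simp
  then have CB: "(C - F) \<union> B = C" "I \<union> (C - F) \<union> B = I \<union> C" for I by auto
  have cm: "matroid (contraction M F)" using matroid_contraction[OF assms(1)] .
  note iffF = indep_contraction_iff[OF assms(1) B] and iffG = indep_contraction_iff[OF assms(1) C(1)]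
  have fin: "finite C" using matroidD(6)[OF assms(1) Ci(1)] .
  have b: "basis_of (contraction M F) (G - F) (C - F)"
  proof (rule basis_ofI[OF cm])
    show "C - F \<in> indep (contraction M F)" 
      unfolding iffF CB using Ci assms(3) by blast
    show "C - F \<subseteq> G - F" using Ci by blast
    have "rank_of (contraction M F) (G - F) + rank_of M F = rank_of M G"
      using rank_of_contraction[OF assms(1), of "G - F" F] assms by (auto simp: Un_absorb2)
    moreover have "card C = card (C - F) + card B"
      using CF fin card_Diff_subset_Int[of C F] card_mono[of C B] C(2) finite_subset[OF C(2) fin] by simp
    ultimately show "card (C - F) = rank_of (contraction M F) (G - F)"
      using basis_of_card[OF assms(1) B] basis_of_card[OF assms(1) C(1)] by linarith
  qed
  have "I \<in> indep (contraction (contraction M F) (G - F)) \<longleftrightarrow> I \<in> indep (contraction M G)" for I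
  proof -
    have "I \<union> (C - F) \<union> B = I \<union> C" by (rule CB)
    moreover have "ground M - F - (G - F) = ground M - G" using assms by blast
    moreover have "I \<union> (C - F) \<subseteq> ground M - F" if "I \<subseteq> ground M - G" using that assms Ci by blast
    ultimately show ?thesis
      using iffG[of I] indep_contraction_iff[OF cm b, of I] iffF[of "I \<union> (C - F)"]
      by (metis ground_contraction)
  qed
  then show ?thesis using assms by (intro set_system.equality) auto
qed

lemma moebius_sum_right:
  assumes "finite L" "finite G" "F \<in> L" "G \<in> L" "F \<subseteq> G"
  shows "(\<Sum>H\<in>{H\<in>L. F \<subseteq> H \<and> H \<subseteq> G}. moebius L F H) = (if F = G then 1 else 0)"
proof (cases "F = G")
  case True
  then have "{H\<in>L. F \<subseteq> H \<and> H \<subseteq> G} = {G}" using assms by auto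
  then show ?thesis using True by (simp add: moebius.simps)
next
  case False
  have "{H\<in>L. F \<subseteq> H \<and> H \<subseteq> G} = insert G {H\<in>L. F \<subseteq> H \<and> H \<subset> G}" using assms by auto
  moreover have "moebius L F G = - (\<Sum>H\<in>{H\<in>L. F \<subseteq> H \<and> H \<subset> G}. moebius L F H)"
    using False assms by (subst moebius.simps) auto
  ultimately show ?thesis using False assms(1) by simp
qed

lemma moebius_sum_left:
  assumes "finite L" "finite H" "K \<in> L" "H \<in> L" "K \<subseteq> H"
  shows "(\<Sum>F\<in>{F\<in>L. K \<subseteq> F \<and> F \<subseteq> H}. moebius L F H) = (if K = H then 1 else 0)"
  using assms(2,4,5)
proof (induction "card H" arbitrary: H rule: less_induct)
  case less
  define g where "g = (\<lambda>H. \<Sum>F\<in>{F\<in>L. K \<subseteq> F \<and> F \<subseteq> H}. moebius L F H)"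
  define I where "I = {F\<in>L. K \<subseteq> F \<and> F \<subseteq> H}"
  have finI: "finite I" using assms(1) by (simp add: I_def)
  have HI: "H \<in> I" "K \<in> I" using less assms by (auto simp: I_def)
  have g0: "g H' = (if K = H' then 1 else 0)" if "H' \<in> I - {H}" for H'
  proof -
    have "H' \<subset> H" using that by (auto simp: I_def)
    then have "card H' < card H" "finite H'" using less.prems(1) by (auto intro: psubset_card_mono finite_subset)
    then show ?thesis using less.hyps[of H'] that by (simp add: g_def I_def)
  qed
  have "(\<Sum>H'\<in>I. g H') = (\<Sum>H'\<in>I. \<Sum>F\<in>I. if F \<subseteq> H' then moebius L F H' else 0)"
  proof (rule sum.cong)
    fix H' assume "H' \<in> I"
    then have "{F\<in>L. K \<subseteq> F \<and> F \<subseteq> H'} = {F\<in>I. F \<subseteq> H'}" by (auto simp: I_def)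
    then show "g H' = (\<Sum>F\<in>I. if F \<subseteq> H' then moebius L F H' else 0)"
      using finI by (simp add: g_def sum.inter_filter)
  qed simp
  also have "\<dots> = (\<Sum>F\<in>I. \<Sum>H'\<in>I. if F \<subseteq> H' then moebius L F H' else 0)"
    by (rule sum.swap)
  also have "\<dots> = (\<Sum>F\<in>I. if F = H then 1 else 0)"
  proof (rule sum.cong)
    fix F assume F: "F \<in> I"
    then have "{H'\<in>I. F \<subseteq> H'} = {H'\<in>L. F \<subseteq> H' \<and> H' \<subseteq> H}" by (auto simp: I_def)
    moreover have "(\<Sum>H'\<in>I. if F \<subseteq> H' then moebius L F H' else 0) = (\<Sum>H'\<in>{H'\<in>I. F \<subseteq> H'}. moebius L F H')"
      using finI by (simp add: sum.inter_filter)
    ultimately show "(\<Sum>H'\<in>I. if F \<subseteq> H' then moebius L F H' else 0) = (if F = H then 1 else 0)"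
      using moebius_sum_right[OF assms(1) less.prems(1), of F] F less.prems(2) by (simp add: I_def)
  qed simp
  also have "\<dots> = 1" using finI HI by simp
  finally have 1: "(\<Sum>H'\<in>I. g H') = 1" .
  have "(\<Sum>H'\<in>I. g H') = g H + (\<Sum>H'\<in>I - {H}. g H')" using finI HI by (simp add: sum.remove)
  also have "(\<Sum>H'\<in>I - {H}. g H') = (\<Sum>H'\<in>I - {H}. if K = H' then 1 else 0)" using g0 by (rule sum.cong[OF refl])
  also have "\<dots> = (if K = H then 0 else 1)" using finI HI by (simp add: sum.delta')
  finally show ?case using 1 by (simp add: g_def split: if_splits)
qed

lemma moebius_down:
  assumes "H \<subseteq> U" "finite H"
  shows "moebius {G\<in>L. G \<subseteq> U} F H = moebius L F H"
  using assms
proof (induction "card H" arbitrary: H rule: less_induct)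
  case less
  let ?L = "{G\<in>L. G \<subseteq> U}"
  have ss: "{X\<in>?L. F \<subseteq> X \<and> X \<subset> H} = {X\<in>L. F \<subseteq> X \<and> X \<subset> H}" using less.prems by auto
  have "moebius ?L F X = moebius L F X" if "X \<subset> H" for X
    using less.hyps[OF psubset_card_mono[OF less.prems(2) that]] that less.prems
      finite_subset[OF psubset_imp_subset[OF that] less.prems(2)] by blast
  then have "(\<Sum>X\<in>{X\<in>?L. F \<subseteq> X \<and> X \<subset> H}. moebius ?L F X) = (\<Sum>X\<in>{X\<in>L. F \<subseteq> X \<and> X \<subset> H}. moebius L F X)"
    unfolding ss by (intro sum.cong refl) simp
  then show ?case by (simp only: moebius.simps[of ?L F H] moebius.simps[of L F H])
qed

lemma moebius_up:
  assumes "F \<subseteq> H" "finite H"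
  shows "moebius ((\<lambda>G. G - F) ` {G\<in>L. F \<subseteq> G}) {} (H - F) = moebius L F H"
  using assms
proof (induction "card H" arbitrary: H rule: less_induct)
  case less
  let ?L = "(\<lambda>G. G - F) ` {G\<in>L. F \<subseteq> G}"
  show ?case
  proof (cases "F = H")
    case False
    then have True: "F \<subset> H \<and> finite H" using less.prems by simp
    have ss: "{X\<in>?L. {} \<subseteq> X \<and> X \<subset> H - F} = (\<lambda>G. G - F) ` {G\<in>L. F \<subseteq> G \<and> G \<subset> H}"
    proof (intro equalityI subsetI)
      fix X assume "X \<in> {X\<in>?L. {} \<subseteq> X \<and> X \<subset> H - F}"
      then obtain G where "G \<in> L" "F \<subseteq> G" "X = G - F" "G - F \<subset> H - F" by auto
      moreover from this have "G \<subset> H" using less.prems(1) by blast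
      ultimately show "X \<in> (\<lambda>G. G - F) ` {G\<in>L. F \<subseteq> G \<and> G \<subset> H}" by blast
    next
      fix X assume "X \<in> (\<lambda>G. G - F) ` {G\<in>L. F \<subseteq> G \<and> G \<subset> H}"
      then obtain G where "G \<in> L" "F \<subseteq> G" "X = G - F" "G \<subset> H" by auto
      moreover from this have "G - F \<subset> H - F" by blast
      ultimately show "X \<in> {X\<in>?L. {} \<subseteq> X \<and> X \<subset> H - F}" by blast
    qed
    have inj: "inj_on (\<lambda>G. G - F) {G\<in>L. F \<subseteq> G \<and> G \<subset> H}" by (auto simp: inj_on_def)
    have "moebius ?L {} (H - F) = - (\<Sum>X\<in>{X\<in>?L. {} \<subseteq> X \<and> X \<subset> H - F}. moebius ?L {} X)"
      using True by (subst moebius.simps) auto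
    also have "\<dots> = - (\<Sum>G\<in>{G\<in>L. F \<subseteq> G \<and> G \<subset> H}. moebius ?L {} (G - F))"
      unfolding ss by (subst sum.reindex[OF inj]) simp
    also have "\<dots> = - (\<Sum>G\<in>{G\<in>L. F \<subseteq> G \<and> G \<subset> H}. moebius L F G)"
    proof (intro arg_cong[where f = uminus] sum.cong refl)
      fix G assume "G \<in> {G\<in>L. F \<subseteq> G \<and> G \<subset> H}"
      then have G: "F \<subseteq> G" "G \<subset> H" by auto
      have "card G < card H" "finite G"
        using G(2) less.prems(2) by (auto intro: psubset_card_mono finite_subset)
      then show "moebius ?L {} (G - F) = moebius L F G" using less.hyps G(1) by blast
    qed
    also have "\<dots> = moebius L F H" using True by (subst (2) moebius.simps) auto
    finally show ?thesis .
  qed (simp add: moebius.simps)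
qed

lemma char_poly_restriction:
  assumes "matroid M" "F \<in> flats M"
  shows "char_poly (restriction M F) =
    (\<Sum>H\<in>{H\<in>flats M. H \<subseteq> F}. monom (moebius (flats M) {} H) (rank_of M F - rank_of M H))"
  unfolding char_poly_def flats_restriction[OF assms]
proof (intro sum.cong refl)
  fix H assume "H \<in> {G\<in>flats M. G \<subseteq> F}"
  then have H: "H \<subseteq> F" "finite H"
    using finite_subset[OF flatsD matroidD(1)[OF assms(1)]] by auto
  then show "monom (moebius {G\<in>flats M. G \<subseteq> F} {} H) (rk (restriction M F) - rank_of (restriction M F) H) =
      monom (moebius (flats M) {} H) (rank_of M F - rank_of M H)"
    by (simp add: moebius_down rk_def rank_of_restriction)
qed

lemma rank_of_contraction_diff:
  assumes "matroid M" "F \<subseteq> G" "G \<subseteq> ground M"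
  shows "rank_of (contraction M F) (G - F) = rank_of M G - rank_of M F"
proof -
  have "G - F \<union> F = G" "G - F \<subseteq> ground M - F" using assms by auto
  then show ?thesis using rank_of_contraction[OF assms(1), of "G - F" F] by simp
qed

lemma char_poly_interval:
  assumes "matroid M" "F \<in> flats M" "G \<in> flats M" "F \<subseteq> G"
  shows "char_poly (restriction (contraction M F) (G - F)) =
    (\<Sum>H\<in>{H\<in>flats M. F \<subseteq> H \<and> H \<subseteq> G}. monom (moebius (flats M) F H) (rank_of M G - rank_of M H))"
proof -
  let ?N = "contraction M F"
  have G: "G - F \<in> flats ?N" using flats_contraction[OF assms(1,2)] assms(3,4) by auto
  have inj: "inj_on (\<lambda>H. H - F) {H\<in>flats M. F \<subseteq> H \<and> H \<subseteq> G}" by (auto simp: inj_on_def)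
  have ss: "{X\<in>flats ?N. X \<subseteq> G - F} = (\<lambda>H. H - F) ` {H\<in>flats M. F \<subseteq> H \<and> H \<subseteq> G}"
  proof (intro equalityI subsetI)
    fix X assume "X \<in> {X\<in>flats ?N. X \<subseteq> G - F}"
    then obtain H where "H \<in> flats M" "F \<subseteq> H" "X = H - F" "H - F \<subseteq> G - F"
      unfolding flats_contraction[OF assms(1,2)] by auto
    moreover from this have "H \<subseteq> G" using assms(4) by blast
    ultimately show "X \<in> (\<lambda>H. H - F) ` {H\<in>flats M. F \<subseteq> H \<and> H \<subseteq> G}" by blast
  next
    fix X assume "X \<in> (\<lambda>H. H - F) ` {H\<in>flats M. F \<subseteq> H \<and> H \<subseteq> G}"
    then obtain H where "H \<in> flats M" "F \<subseteq> H" "X = H - F" "H \<subseteq> G" by auto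
    moreover from this have "H - F \<subseteq> G - F" by blast
    ultimately show "X \<in> {X\<in>flats ?N. X \<subseteq> G - F}"
      unfolding flats_contraction[OF assms(1,2)] by blast
  qed
  have "monom (moebius (flats ?N) {} (H - F)) (rank_of ?N (G - F) - rank_of ?N (H - F)) =
        monom (moebius (flats M) F H) (rank_of M G - rank_of M H)"
    if H: "H \<in> flats M" "F \<subseteq> H" "H \<subseteq> G" for H
  proof -
    have "rank_of M F \<le> rank_of M H" "rank_of M H \<le> rank_of M G"
      using rank_of_mono[OF assms(1)] H by auto
    moreover have "finite H" using flatsD[OF H(1)] matroidD(1)[OF assms(1)] finite_subset by blast
    ultimately show ?thesis
      using rank_of_contraction_diff[OF assms(1) H(2) flatsD[OF H(1)]]
        rank_of_contraction_diff[OF assms(1) assms(4) flatsD[OF assms(3)]]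
        moebius_up[OF H(2), of "flats M"] flats_contraction[OF assms(1,2)] by simp
  qed
  then show ?thesis
    unfolding char_poly_restriction[OF matroid_contraction[OF assms(1)] G] ss
    by (subst sum.reindex[OF inj]) (auto intro!: sum.cong)
qed

lemma reverse_poly_monom: "k \<le> n \<Longrightarrow> reverse_poly n (monom c k) = monom c (n - k)"
  by (rule poly_eqI) (auto simp: coeff_reverse_poly)

lemma reverse_poly_1: "reverse_poly 0 1 = 1"
  by (rule poly_eqI) (auto simp: coeff_reverse_poly)

lemma reverse_poly_sum: "reverse_poly n (sum f A) = (\<Sum>a\<in>A. reverse_poly n (f a))"
  by (rule poly_eqI) (simp add: coeff_reverse_poly coeff_sum)

lemma reverse_poly_mult:
  assumes "degree p \<le> a" "degree q \<le> b"
  shows "reverse_poly (a + b) (p * q) = reverse_poly a p * reverse_poly b q"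
proof -
  have p: "p = (\<Sum>i\<le>a. monom (coeff p i) i)" and q: "q = (\<Sum>j\<le>b. monom (coeff q j) j)"
    using assms by (simp_all add: poly_as_sum_of_monoms')
  have "reverse_poly (a + b) (p * q) =
      reverse_poly (a + b) (\<Sum>i\<le>a. \<Sum>j\<le>b. monom (coeff p i * coeff q j) (i + j))"
    by (subst p, subst q) (simp only: sum_product mult_monom)
  also have "\<dots> = (\<Sum>i\<le>a. \<Sum>j\<le>b. monom (coeff p i * coeff q j) ((a - i) + (b - j)))"
    unfolding reverse_poly_sum by (intro sum.cong) (auto simp: reverse_poly_monom)
  also have "\<dots> = reverse_poly a p * reverse_poly b q"
    unfolding reverse_poly_def sum_product mult_monom ..
  finally show ?thesis .
qed

lemma degree_char_poly_restriction:
  assumes "matroid M" "F \<in> flats M"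
  shows "degree (char_poly (restriction M F)) \<le> rank_of M F"
  unfolding char_poly_restriction[OF assms]
  by (intro degree_sum_le) (auto intro: order_trans[OF degree_monom_le] simp: finite_flats[OF assms(1)])

lemma char_poly_kernel:
  assumes "matroid M" "loopless M" "G \<in> flats M" "G \<noteq> {}"
  shows "(\<Sum>F\<in>{F\<in>flats M. F \<subseteq> G}. reverse_poly (rank_of M F) (char_poly (restriction M F)) *
            char_poly (restriction (contraction M F) (G - F))) = 0"
proof -
  let ?L = "flats M" and ?I = "{F\<in>flats M. F \<subseteq> G}" and ?mu = "moebius (flats M)" and ?r = "rank_of M"
  have finL: "finite ?L" and fin: "finite ?I" using finite_flats[OF assms(1)] by auto
  have finF: "finite F" if "F \<in> ?L" for F using that flatsD matroidD(1)[OF assms(1)] finite_subset by blast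
  have 1: "reverse_poly (?r F) (char_poly (restriction M F)) =
      (\<Sum>K\<in>?I. if K \<subseteq> F then monom (?mu {} K) (?r K) else 0)" if F: "F \<in> ?I" for F
  proof -
    have "reverse_poly (?r F) (char_poly (restriction M F)) =
        (\<Sum>K\<in>{K\<in>?L. K \<subseteq> F}. monom (?mu {} K) (?r K))"
      using F rank_of_mono[OF assms(1)]
      by (auto simp: char_poly_restriction[OF assms(1)] reverse_poly_sum reverse_poly_monom intro!: sum.cong)
    also have "{K\<in>?L. K \<subseteq> F} = {K\<in>?I. K \<subseteq> F}" using F by auto
    finally show ?thesis unfolding sum.inter_filter[OF fin] .
  qed
  have 2: "char_poly (restriction (contraction M F) (G - F)) =
      (\<Sum>H\<in>?I. if F \<subseteq> H then monom (?mu F H) (?r G - ?r H) else 0)" if F: "F \<in> ?I" for F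
  proof -
    have "{H\<in>?L. F \<subseteq> H \<and> H \<subseteq> G} = {H\<in>?I. F \<subseteq> H}" by auto
    then show ?thesis
      using F char_poly_interval[OF assms(1) _ assms(3), of F] unfolding sum.inter_filter[OF fin, symmetric] by simp
  qed
  have 3: "(\<Sum>F\<in>?I. if K \<subseteq> F \<and> F \<subseteq> H then monom (?mu {} K * ?mu F H) (?r K + (?r G - ?r H)) else 0) =
      (if K = H then monom (?mu {} K) (?r G) else 0)" (is "?lhs = _") if KH: "K \<in> ?I" "H \<in> ?I" for K H
  proof -
    have s: "{F\<in>?I. K \<subseteq> F \<and> F \<subseteq> H} = {F\<in>?L. K \<subseteq> F \<and> F \<subseteq> H}" using KH by auto
    have m: "monom (\<Sum>F\<in>A. c F) e = (\<Sum>F\<in>A. monom (c F) e)" for A :: "'a set set" and c :: "'a set \<Rightarrow> int" and e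
      by (rule poly_eqI) (simp add: coeff_sum)
    have "?lhs = (\<Sum>F\<in>{F\<in>?L. K \<subseteq> F \<and> F \<subseteq> H}. monom (?mu {} K * ?mu F H) (?r K + (?r G - ?r H)))"
      unfolding s[symmetric] sum.inter_filter[OF fin] ..
    also have "\<dots> = monom (?mu {} K * (\<Sum>F\<in>{F\<in>?L. K \<subseteq> F \<and> F \<subseteq> H}. ?mu F H)) (?r K + (?r G - ?r H))"
      by (simp add: m sum_distrib_left)
    also have "(\<Sum>F\<in>{F\<in>?L. K \<subseteq> F \<and> F \<subseteq> H}. ?mu F H) = (if K = H then 1 else 0)"
    proof (cases "K \<subseteq> H")
      case True
      then show ?thesis using moebius_sum_left[OF finL finF] KH by simp
    next
      case False
      then have "{F\<in>?L. K \<subseteq> F \<and> F \<subseteq> H} = {}" by auto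
      then show ?thesis using False by (metis sum.empty subset_refl)
    qed
    finally show ?thesis using KH rank_of_mono[OF assms(1), of H G] by auto
  qed
  have "(\<Sum>F\<in>?I. reverse_poly (?r F) (char_poly (restriction M F)) *
            char_poly (restriction (contraction M F) (G - F))) =
      (\<Sum>F\<in>?I. \<Sum>K\<in>?I. \<Sum>H\<in>?I. if K \<subseteq> F \<and> F \<subseteq> H then monom (?mu {} K * ?mu F H) (?r K + (?r G - ?r H)) else 0)"
    by (rule sum.cong[OF refl], simp only: 1 2 sum_product) (intro sum.cong, auto simp: mult_monom)
  also have "\<dots> = (\<Sum>K\<in>?I. \<Sum>F\<in>?I. \<Sum>H\<in>?I. if K \<subseteq> F \<and> F \<subseteq> H then monom (?mu {} K * ?mu F H) (?r K + (?r G - ?r H)) else 0)"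
    by (rule sum.swap)
  also have "\<dots> = (\<Sum>K\<in>?I. \<Sum>H\<in>?I. \<Sum>F\<in>?I. if K \<subseteq> F \<and> F \<subseteq> H then monom (?mu {} K * ?mu F H) (?r K + (?r G - ?r H)) else 0)"
    by (rule sum.cong[OF refl]) (rule sum.swap)
  also have "\<dots> = (\<Sum>K\<in>?I. \<Sum>H\<in>?I. if K = H then monom (?mu {} K) (?r G) else 0)"
    by (intro sum.cong refl 3)
  also have "\<dots> = (\<Sum>K\<in>?I. monom (?mu {} K) (?r G))"
    using fin by (intro sum.cong) (auto simp: sum.delta)
  also have "\<dots> = monom (\<Sum>K\<in>{K\<in>?L. {} \<subseteq> K \<and> K \<subseteq> G}. ?mu {} K) (?r G)"
    by (rule poly_eqI) (simp add: coeff_sum)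
  also have "\<dots> = 0"
    using moebius_sum_right[OF finL finF[OF assms(3)] empty_in_flats[OF assms(1,2)] assms(3)] assms(4) by simp
  finally show ?thesis .
qed

lemma card_contraction_less:
  assumes "matroid M" "F \<in> flats M - {{}}"
  shows "card (ground (contraction M F)) < card (ground M)"
proof -
  have "ground M - F \<subset> ground M" using assms(2) flatsD[of F M] by blast
  then show ?thesis using matroidD(1)[OF assms(1)] by (simp add: psubset_card_mono)
qed

text \<open>Auxiliary, for the existence of a \<open>kl_assignment\<close>.\<close>

function kl_rec :: "'a set_system \<Rightarrow> int poly" where
  "kl_rec M =
     (if matroid M \<and> loopless M then
        (THE p. (rk M = 0 \<longrightarrow> p = 1) \<and> (rk M > 0 \<longrightarrow> 2 * degree p < rk M) \<and>
                reverse_poly (rk M) p =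
                  p + (\<Sum>F\<in>flats M - {{}}. char_poly (restriction M F) * kl_rec (contraction M F)))
      else 0)"
  by pat_completeness auto
termination
proof (relation "measure (\<lambda>M. card (ground M))")
  fix M :: "'a set_system" and p :: "int poly" and F
  assume "matroid M \<and> loopless M" "F \<in> flats M - {{}}"
  then show "(contraction M F, M) \<in> measure (\<lambda>M. card (ground M))"
    using card_contraction_less[of M F] by simp
qed simp

declare kl_rec.simps [simp del]

lemma kl_equation_unique:
  assumes "2 * degree p < n" "2 * degree q < n"
    and "reverse_poly n p = p + R" "reverse_poly n q = q + R"
  shows "p = q"
proof (rule poly_eqI)
  fix i
  have c: "coeff (reverse_poly n p) j - coeff p j = coeff (reverse_poly n q) j - coeff q j" for j
    using assms(3,4) by simp
  show "coeff p i = coeff q i"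
  proof (cases "2 * i < n")
    case True
    then have "degree p < n - i" "degree q < n - i" using assms by auto
    then show ?thesis using c[of "n - i"] True by (simp add: coeff_reverse_poly coeff_eq_0)
  next
    case False
    then show ?thesis using assms by (simp add: coeff_eq_0)
  qed
qed

lemma kl_equation_exists:
  assumes "degree R \<le> n" "reverse_poly n R = - R" "n > 0"
  shows "\<exists>p. 2 * degree p < n \<and> reverse_poly n p = p + R"
proof -
  define p where "p = (\<Sum>i\<in>{i. 2 * i < n}. monom (coeff R (n - i)) i)"
  have fin: "finite {i. 2 * i < n}" by (rule finite_subset[of _ "{..n}"]) auto
  have cp: "coeff p i = (if 2 * i < n then coeff R (n - i) else 0)" for i
    using fin by (simp add: p_def coeff_sum sum.delta)
  have cR: "coeff R (n - j) = - coeff R j" if "j \<le> n" for j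
    using arg_cong[OF assms(2), of "\<lambda>p. coeff p j"] that by (simp add: coeff_reverse_poly)
  have "degree p \<le> (n - 1) div 2" by (rule degree_le) (auto simp: cp)
  then have "2 * degree p < n" using assms(3) by linarith
  moreover have "reverse_poly n p = p + R"
  proof (rule poly_eqI)
    fix j
    show "coeff (reverse_poly n p) j = coeff (p + R) j"
    proof (cases "j \<le> n")
      case True
      consider "2 * j < n" | "2 * j = n" | "2 * j > n" by linarith
      then show ?thesis
      proof cases
        case 2
        then have "n - j = j" by simp
        then have "coeff R j = 0" using cR[OF True] by simp
        then show ?thesis using 2 True by (simp add: coeff_reverse_poly cp)
      qed (use True cR[OF True] in \<open>auto simp: coeff_reverse_poly cp\<close>)
    next
      case False
      then show ?thesis using assms(1) by (simp add: coeff_reverse_poly cp coeff_eq_0)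
    qed
  qed
  ultimately show ?thesis by blast
qed

lemma kl_sum_split:
  assumes "matroid M" "loopless M"
  shows "(\<Sum>F\<in>flats M. char_poly (restriction M F) * P (contraction M F)) =
    P M + (\<Sum>F\<in>flats M - {{}}. char_poly (restriction M F) * P (contraction M F))"
  by (subst sum.remove[OF finite_flats[OF assms(1)] empty_in_flats[OF assms]])
    (simp add: char_poly_restriction_empty[OF assms(1)] contraction_empty[OF assms(1)])

lemma rk_eq_0:
  assumes "matroid M" "loopless M" "rk M = 0"
  shows "flats M = {{}}"
proof -
  have "ground M = {}"
  proof (rule ccontr)
    assume "ground M \<noteq> {}"
    then obtain x where "x \<in> ground M" by blast
    then show False using card_le_rank_of[OF assms(1), of "{x}" "ground M"] assms(2,3)
      by (simp add: loopless_def rk_def)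
  qed
  then show ?thesis using empty_in_flats[OF assms(1,2)] flatsD by blast
qed

lemma kl_rec_correct:
  assumes "matroid M" "loopless M"
  shows "(rk M = 0 \<longrightarrow> kl_rec M = 1) \<and> (rk M > 0 \<longrightarrow> 2 * degree (kl_rec M) < rk M) \<and>
    reverse_poly (rk M) (kl_rec M) =
      kl_rec M + (\<Sum>F\<in>flats M - {{}}. char_poly (restriction M F) * kl_rec (contraction M F))"
  using assms
proof (induction "card (ground M)" arbitrary: M rule: less_induct)
  case less
  note M = less.prems
  let ?L = "flats M" and ?r = "rank_of M"
  define R where "R = (\<Sum>F\<in>?L - {{}}. char_poly (restriction M F) * kl_rec (contraction M F))"
  have finL: "finite ?L" using finite_flats[OF M(1)] .
  define C where "C = (\<lambda>p. (rk M = 0 \<longrightarrow> p = 1) \<and> (rk M > 0 \<longrightarrow> 2 * degree p < rk M) \<and>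
    reverse_poly (rk M) p = p + (R :: int poly))"
  have IH: "(rk (contraction M F) = 0 \<longrightarrow> kl_rec (contraction M F) = 1) \<and>
      (rk (contraction M F) > 0 \<longrightarrow> 2 * degree (kl_rec (contraction M F)) < rk (contraction M F)) \<and>
      reverse_poly (rk (contraction M F)) (kl_rec (contraction M F)) =
      (\<Sum>X\<in>flats (contraction M F). char_poly (restriction (contraction M F) X) * kl_rec (contraction (contraction M F) X))"
    if F: "F \<in> ?L - {{}}" for F
    using less.hyps[OF card_contraction_less[OF M(1) F] matroid_contraction[OF M(1)] loopless_contraction[OF M(1)]] F
      kl_sum_split[OF matroid_contraction[OF M(1)] loopless_contraction[OF M(1)], of F kl_rec] by simp
  have rkF: "?r F + rk (contraction M F) = rk M" if "F \<in> ?L" for F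
    using rank_of_contraction[OF M(1), of "ground M - F" F] flatsD[OF that]
    by (simp add: rk_def Un_absorb2 add.commute)
  have dP: "degree (kl_rec (contraction M F)) \<le> rk (contraction M F)" if F: "F \<in> ?L - {{}}" for F
    using IH[OF F] by (cases "rk (contraction M F) = 0") auto
  have dC: "degree (char_poly (restriction M F)) \<le> ?r F" if "F \<in> ?L" for F
    using degree_char_poly_restriction[OF M(1) that] .
  have degR: "degree R \<le> rk M"
    unfolding R_def
  proof (rule degree_sum_le)
    fix F assume F: "F \<in> ?L - {{}}"
    then show "degree (char_poly (restriction M F) * kl_rec (contraction M F)) \<le> rk M"
      using degree_mult_le[of "char_poly (restriction M F)" "kl_rec (contraction M F)"] dP[OF F] dC[of F] rkF[of F]
      by simp
  qed (use finL in simp)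
  define T where "T = (\<lambda>F G. reverse_poly (?r F) (char_poly (restriction M F)) *
      char_poly (restriction (contraction M F) (G - F)))"
  have revR: "reverse_poly (rk M) R = - R"
  proof -
    have "reverse_poly (rk M) R = (\<Sum>F\<in>?L - {{}}. \<Sum>G\<in>?L. if F \<subseteq> G then T F G * kl_rec (contraction M G) else 0)"
      unfolding R_def reverse_poly_sum
    proof (rule sum.cong[OF refl])
      fix F assume F: "F \<in> ?L - {{}}"
      then have FL: "F \<in> ?L" by simp
      have inj: "inj_on (\<lambda>G. G - F) {G\<in>?L. F \<subseteq> G}" by (auto simp: inj_on_def)
      have "reverse_poly (rk M) (char_poly (restriction M F) * kl_rec (contraction M F)) =
          reverse_poly (?r F) (char_poly (restriction M F)) *
          reverse_poly (rk (contraction M F)) (kl_rec (contraction M F))"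
        using reverse_poly_mult[OF dC[OF FL] dP[OF F]] rkF[OF FL] by simp
      also have "reverse_poly (rk (contraction M F)) (kl_rec (contraction M F)) =
          (\<Sum>G\<in>{G\<in>?L. F \<subseteq> G}. char_poly (restriction (contraction M F) (G - F)) *
             kl_rec (contraction (contraction M F) (G - F)))"
        using IH[OF F] unfolding flats_contraction[OF M(1) FL] by (simp add: sum.reindex[OF inj])
      also have "\<dots> = (\<Sum>G\<in>{G\<in>?L. F \<subseteq> G}. char_poly (restriction (contraction M F) (G - F)) *
             kl_rec (contraction M G))"
        by (intro sum.cong refl) (simp add: contraction_contraction[OF M(1) _ flatsD])
      finally show "reverse_poly (rk M) (char_poly (restriction M F) * kl_rec (contraction M F)) =
          (\<Sum>G\<in>?L. if F \<subseteq> G then T F G * kl_rec (contraction M G) else 0)"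
        using finL by (simp add: sum_distrib_left T_def mult.assoc flip: sum.inter_filter)
    qed
    also have "\<dots> = (\<Sum>G\<in>?L. \<Sum>F\<in>?L - {{}}. if F \<subseteq> G then T F G * kl_rec (contraction M G) else 0)"
      by (rule sum.swap)
    also have "\<dots> = (\<Sum>G\<in>?L. if G = {} then 0 else - (char_poly (restriction M G) * kl_rec (contraction M G)))"
    proof (rule sum.cong[OF refl])
      fix G assume G: "G \<in> ?L"
      have e: "(\<Sum>F\<in>?L - {{}}. if F \<subseteq> G then T F G * kl_rec (contraction M G) else 0) =
          (\<Sum>F\<in>{F\<in>?L. F \<subseteq> G} - {{}}. T F G) * kl_rec (contraction M G)"
      proof -
        have "{F \<in> ?L - {{}}. F \<subseteq> G} = {F\<in>?L. F \<subseteq> G} - {{}}" by auto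
        then show ?thesis using finL by (simp add: sum_distrib_right flip: sum.inter_filter)
      qed
      show "(\<Sum>F\<in>?L - {{}}. if F \<subseteq> G then T F G * kl_rec (contraction M G) else 0) =
          (if G = {} then 0 else - (char_poly (restriction M G) * kl_rec (contraction M G)))"
      proof (cases "G = {}")
        case True
        then have "{F\<in>?L. F \<subseteq> G} - {{}} = {}" by auto
        then have "(\<Sum>F\<in>{F\<in>?L. F \<subseteq> G} - {{}}. T F G) = 0" by (simp only: sum.empty)
        then show ?thesis unfolding e using True by simp
      next
        case False
        have "T {} G = char_poly (restriction M G)"
          by (simp add: T_def char_poly_restriction_empty[OF M(1)] contraction_empty[OF M(1)] rank_of_empty[OF M(1)] reverse_poly_1)
        moreover have "(\<Sum>F\<in>{F\<in>?L. F \<subseteq> G}. T F G) = T {} G + (\<Sum>F\<in>{F\<in>?L. F \<subseteq> G} - {{}}. T F G)"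
          using finL empty_in_flats[OF M] by (intro sum.remove) auto
        moreover have "(\<Sum>F\<in>{F\<in>?L. F \<subseteq> G}. T F G) = 0"
          unfolding T_def by (rule char_poly_kernel[OF M G False])
        ultimately have "(\<Sum>F\<in>{F\<in>?L. F \<subseteq> G} - {{}}. T F G) = - char_poly (restriction M G)"
          by (simp add: eq_neg_iff_add_eq_0 add.commute)
        then show ?thesis unfolding e using False by simp
      qed
    qed
    also have "\<dots> = (\<Sum>G\<in>?L - {{}}. - (char_poly (restriction M G) * kl_rec (contraction M G)))"
      using finL by (intro sum.mono_neutral_cong_right) auto
    also have "\<dots> = - R" by (simp add: R_def sum_negf)
    finally show ?thesis .
  qed
  have "\<exists>!p. C p"
  proof (cases "rk M = 0")
    case True
    then have "R = 0" using rk_eq_0[OF M] by (simp add: R_def)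
    then show ?thesis using True by (auto simp: C_def reverse_poly_1)
  next
    case False
    then obtain p where "C p" using kl_equation_exists[OF degR revR] by (auto simp: C_def)
    moreover have "q = p" if "C q" for q
      using that \<open>C p\<close> False kl_equation_unique[of q "rk M" p R] by (simp add: C_def)
    ultimately show ?thesis by blast
  qed
  moreover have "kl_rec M = (THE p. C p)"
    unfolding C_def R_def using M by (subst kl_rec.simps) simp
  ultimately have "C (kl_rec M)" using theI'[of "C"] by simp
  then show ?case by (simp add: C_def R_def)
qed

lemma kl_assignment_kl_rec: "kl_assignment (kl_rec :: 'a set_system \<Rightarrow> int poly)"
  unfolding kl_assignment_def
proof (intro allI impI, elim conjE)
  fix M :: "'a set_system"
  assume M: "matroid M" "loopless M"
  show "(rk M = 0 \<longrightarrow> kl_rec M = 1) \<and> (rk M > 0 \<longrightarrow> 2 * degree (kl_rec M) < rk M) \<and>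
      reverse_poly (rk M) (kl_rec M) =
        (\<Sum>F\<in>flats M. char_poly (restriction M F) * kl_rec (contraction M F))"
    unfolding kl_sum_split[OF M] by (rule kl_rec_correct[OF M])
qed

lemma kl_assignment_unique:
  assumes "kl_assignment P" "kl_assignment Q" "matroid M" "loopless M"
  shows "P M = Q M"
  using assms(3,4)
proof (induction "card (ground M)" arbitrary: M rule: less_induct)
  case less
  note M = less.prems
  have eq: "(\<Sum>F\<in>flats M - {{}}. char_poly (restriction M F) * P (contraction M F)) =
      (\<Sum>F\<in>flats M - {{}}. char_poly (restriction M F) * Q (contraction M F))"
    using less.hyps[OF card_contraction_less[OF M(1)] matroid_contraction[OF M(1)] loopless_contraction[OF M(1)]]
    by (intro sum.cong) auto
  have P: "rk M = 0 \<longrightarrow> P M = 1" "rk M > 0 \<longrightarrow> 2 * degree (P M) < rk M"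
    "reverse_poly (rk M) (P M) = P M + (\<Sum>F\<in>flats M - {{}}. char_poly (restriction M F) * P (contraction M F))"
    using assms(1) M kl_sum_split[OF M, of P] by (auto simp: kl_assignment_def)
  have Q: "rk M = 0 \<longrightarrow> Q M = 1" "rk M > 0 \<longrightarrow> 2 * degree (Q M) < rk M"
    "reverse_poly (rk M) (Q M) = Q M + (\<Sum>F\<in>flats M - {{}}. char_poly (restriction M F) * P (contraction M F))"
    unfolding eq using assms(2) M kl_sum_split[OF M, of Q] by (auto simp: kl_assignment_def)
  show ?case
  proof (cases "rk M = 0")
    case False
    then show ?thesis using P Q kl_equation_unique[of "P M" "rk M" "Q M"] by simp
  qed (use P Q in simp)
qed

theorem kl_assignment_kl_poly: "kl_assignment (kl_poly :: 'a set_system \<Rightarrow> int poly)"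
proof -
  let ?C = "\<lambda>P :: 'a set_system \<Rightarrow> int poly. kl_assignment P \<and> (\<forall>M. \<not> (matroid M \<and> loopless M) \<longrightarrow> P M = 0)"
  have "?C kl_rec" using kl_assignment_kl_rec by (simp add: kl_rec.simps)
  moreover have "P = kl_rec" if "?C P" for P
  proof
    fix M
    show "P M = kl_rec M"
      using that \<open>?C kl_rec\<close> kl_assignment_unique[of P kl_rec M] by (cases "matroid M \<and> loopless M") auto
  qed
  ultimately have "(THE P. ?C P) = kl_rec" by (rule the_equality)
  then show ?thesis unfolding kl_poly_def using kl_assignment_kl_rec by simp
qed

lemma matroid_uniform_matroid:
  assumes "finite E"
  shows "matroid (uniform_matroid E d)"
proof -
  let ?U = "uniform_matroid E d"
  have U: "ground ?U = E" "I \<in> indep ?U \<longleftrightarrow> I \<subseteq> E \<and> card I \<le> d" for I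
    by (simp_all add: uniform_matroid_def)
  show ?thesis
    unfolding matroid_def U(1)
  proof (intro conjI ballI allI impI)
    show "indep ?U \<subseteq> Pow E" using U(2) by blast
    show "{} \<in> indep ?U" using U(2) by simp
  next
    fix I J assume "I \<in> indep ?U" "J \<subseteq> I"
    then show "J \<in> indep ?U"
      using U(2) card_mono[of I J] finite_subset[OF _ assms, of I] by (meson order_trans)
  next
    fix I J assume IJ: "I \<in> indep ?U" "J \<in> indep ?U" "card I < card J"
    then have "finite I" using U(2) finite_subset[OF _ assms] by blast
    then have "\<not> J \<subseteq> I" using IJ(3) card_mono[of I J] by linarith
    then obtain x where x: "x \<in> J - I" by blast
    then have "insert x I \<in> indep ?U"
      using IJ \<open>finite I\<close> unfolding U(2) by auto
    then show "\<exists>x\<in>J - I. insert x I \<in> indep ?U" using x by blast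
  qed (rule assms)
qed

lemma loopless_uniform_matroid: "1 \<le> d \<Longrightarrow> loopless (uniform_matroid E d)"
  by (simp add: loopless_def uniform_matroid_def)

lemma rk_uniform_matroid:
  assumes "finite E" "d \<le> card E"
  shows "rk (uniform_matroid E d) = d"
proof (rule antisym)
  obtain I where "I \<subseteq> E" "card I = d" using obtain_subset_with_card_n[OF assms(2)] by metis
  then show "d \<le> rk (uniform_matroid E d)"
    using card_le_rank_of[OF matroid_uniform_matroid[OF assms(1)], of I d E]
    by (simp add: rk_def uniform_matroid_def)
  obtain J where "J \<in> indep (uniform_matroid E d)" "card J = rk (uniform_matroid E d)"
    unfolding rk_def by (rule rank_of_attained[OF matroid_uniform_matroid[OF assms(1)]])
  then show "rk (uniform_matroid E d) \<le> d" by (simp add: uniform_matroid_def)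
qed

end

theory Submission
  imports Defs "HOL-Computational_Algebra.Computational_Algebra"
begin

text \<open>
  The \<open>Z\<close>-polynomial is palindromic, and together with the degree bound on \<open>P\<close> this determines both
  polynomials of \<open>U\<^sub>m\<^sub>,\<^sub>d\<close>. With \<open>N = m + d\<close> and \<open>s = i (d - i)\<close>, the coefficient of \<open>t\<^sup>i\<close> in \<open>Z\<close> is, up to
  a constant, \<open>C(N,i) C(N,d-i) R(s)\<close>, where \<open>R = S\<^sub>0 + \<dots> + S\<^sub>m\<^sub>-\<^sub>1\<close> and \<open>S\<^sub>n\<close> is a partial sum of Gauss's series
  \<open>F(i, d - i; 1; 1)\<close>, a polynomial in \<open>s\<close>. By the Chu--Vandermonde identity \<open>S\<^sub>n\<close> alternates in sign at
  the points \<open>s = - b (d + b)\<close>, so it is real-rooted. Its zeros for \<open>n = m - 1\<close> interlace those of \<open>R\<close>, so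
  \<open>R\<close> is a product of factors \<open>s + \<beta>\<close> with \<open>\<beta> > 0\<close>, up to a constant. Each factor equals
  \<open>(i + x) (d - i + x)\<close> with \<open>x > 0\<close>, and multiplying the coefficients by it preserves the property of
  having only negative zeros. The polynomial \<open>\<Sum> C(N,i) C(N,d-i) t\<^sup>i\<close> has this property by the
  Gauss--Lucas theorem, applied to the derivatives of \<open>x\<^sup>N (x - 1)\<^sup>N\<close>.
\<close>

section \<open>The Z-polynomial of a uniform matroid\<close>

lemma kl_poly_props:
  assumes "matroid M" "loopless M"
  shows kl_poly_rk_0: "rk M = 0 \<Longrightarrow> kl_poly M = 1"
    and degree_kl_poly: "rk M > 0 \<Longrightarrow> 2 * degree (kl_poly M) < rk M"
    and kl_poly_equation: "reverse_poly (rk M) (kl_poly M) =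
      (\<Sum>F\<in>flats M. char_poly (restriction M F) * kl_poly (contraction M F))"
  using kl_assignment_kl_poly assms unfolding kl_assignment_def by blast+

lemma rk_restriction: "rk (restriction M F) = rank_of M F"
  by (simp add: rk_def rank_of_restriction)

lemma rank_of_add_rk_contraction:
  assumes "matroid M" "F \<in> flats M"
  shows "rank_of M F + rk (contraction M F) = rk M"
  using rank_of_contraction[OF assms(1), of "ground M - F" F] flatsD[OF assms(2)]
  by (simp add: rk_def Un_absorb2 add.commute)

text \<open>Expand each characteristic polynomial over the flats H between F and G and swap the
  sums: the inner sum of Moebius values over all F below H vanishes unless H is empty. This is the
  cancellation behind palindromicity.\<close>

lemma sum_char_poly_interval:
  assumes "matroid M" "loopless M" "G \<in> flats M"
  shows "(\<Sum>F\<in>{F\<in>flats M. F \<subseteq> G}. char_poly (restriction (contraction M F) (G - F))) =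
    monom 1 (rank_of M G)"
proof -
  let ?I = "{F\<in>flats M. F \<subseteq> G}" and ?mu = "moebius (flats M)" and ?r = "rank_of M"
  have finL: "finite (flats M)" and fin: "finite ?I" using finite_flats[OF assms(1)] by auto
  have "(\<Sum>F\<in>?I. char_poly (restriction (contraction M F) (G - F))) =
      (\<Sum>F\<in>?I. \<Sum>H\<in>?I. if F \<subseteq> H then monom (?mu F H) (?r G - ?r H) else 0)"
  proof (rule sum.cong[OF refl])
    fix F assume F: "F \<in> ?I"
    have "{H\<in>flats M. F \<subseteq> H \<and> H \<subseteq> G} = {H\<in>?I. F \<subseteq> H}" by auto
    then show "char_poly (restriction (contraction M F) (G - F)) =
        (\<Sum>H\<in>?I. if F \<subseteq> H then monom (?mu F H) (?r G - ?r H) else 0)"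
      using F char_poly_interval[OF assms(1) _ assms(3), of F]
      unfolding sum.inter_filter[OF fin, symmetric] by simp
  qed
  also have "\<dots> = (\<Sum>H\<in>?I. \<Sum>F\<in>?I. if F \<subseteq> H then monom (?mu F H) (?r G - ?r H) else 0)"
    by (rule sum.swap)
  also have "\<dots> = (\<Sum>H\<in>?I. if H = {} then monom 1 (?r G) else 0)"
  proof (rule sum.cong[OF refl])
    fix H assume H: "H \<in> ?I"
    have finH: "finite H" using H finite_subset[OF flatsD matroidD(1)[OF assms(1)]] by simp
    have s: "{F\<in>?I. F \<subseteq> H} = {F\<in>flats M. {} \<subseteq> F \<and> F \<subseteq> H}" using H by auto
    have "(\<Sum>F\<in>?I. if F \<subseteq> H then monom (?mu F H) (?r G - ?r H) else 0) =
        (\<Sum>F\<in>{F\<in>?I. F \<subseteq> H}. monom (?mu F H) (?r G - ?r H))"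
      unfolding sum.inter_filter[OF fin] ..
    also have "\<dots> = monom (\<Sum>F\<in>{F\<in>?I. F \<subseteq> H}. ?mu F H) (?r G - ?r H)"
      by (rule poly_eqI) (simp add: coeff_sum)
    also have "(\<Sum>F\<in>{F\<in>?I. F \<subseteq> H}. ?mu F H) = (if {} = H then 1 else 0)"
      unfolding s using H by (intro moebius_sum_left finL finH empty_in_flats assms) auto
    finally show "(\<Sum>F\<in>?I. if F \<subseteq> H then monom (?mu F H) (?r G - ?r H) else 0) =
        (if H = {} then monom 1 (?r G) else 0)"
      by (auto simp: rank_of_empty[OF assms(1)])
  qed
  also have "\<dots> = monom 1 (?r G)"
    using fin empty_in_flats[OF assms(1,2)] by (simp add: sum.delta)
  finally show ?thesis .
qed

text \<open>Reversing the summand of F cancels its power of t and leaves the reversal of P of the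
  contraction, which the defining equation expands over the flats G above F. After swapping the
  sums, the characteristic polynomials of the intervals from F to G add up to the power of t
  belonging to G.\<close>

lemma z_poly_palindromic:
  assumes "matroid M" "loopless M"
  shows "reverse_poly (rk M) (z_poly M) = z_poly M"
proof -
  let ?L = "flats M" and ?r = "rank_of M"
  let ?T = "\<lambda>F G. char_poly (restriction (contraction M F) (G - F))"
  have finL: "finite ?L" using finite_flats[OF assms(1)] .
  have "reverse_poly (rk M) (z_poly M) =
      (\<Sum>F\<in>?L. \<Sum>G\<in>?L. if F \<subseteq> G then ?T F G * kl_poly (contraction M G) else 0)"
    unfolding z_poly_def reverse_poly_sum
  proof (rule sum.cong[OF refl])
    fix F assume F: "F \<in> ?L"
    let ?N = "contraction M F"
    have N: "matroid ?N" "loopless ?N"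
      using matroid_contraction[OF assms(1)] loopless_contraction[OF assms(1) F] by auto
    have "degree (kl_poly ?N) \<le> rk ?N"
      using kl_poly_rk_0[OF N] degree_kl_poly[OF N] by (cases "rk ?N = 0") auto
    then have "reverse_poly (rk M) (monom 1 (rk (restriction M F)) * kl_poly ?N) =
        reverse_poly (?r F) (monom 1 (?r F)) * reverse_poly (rk ?N) (kl_poly ?N)"
      using reverse_poly_mult[of "monom 1 (?r F)" "?r F" "kl_poly ?N" "rk ?N"]
        rank_of_add_rk_contraction[OF assms(1) F]
      by (simp add: rk_restriction degree_monom_le)
    also have "\<dots> = reverse_poly (rk ?N) (kl_poly ?N)"
      by (simp add: reverse_poly_monom)
    also have "\<dots> = (\<Sum>G\<in>{G\<in>?L. F \<subseteq> G}. ?T F G * kl_poly (contraction ?N (G - F)))"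
    proof -
      have inj: "inj_on (\<lambda>G. G - F) {G\<in>?L. F \<subseteq> G}" by (auto simp: inj_on_def)
      show ?thesis
        unfolding kl_poly_equation[OF N] flats_contraction[OF assms(1) F]
        by (simp add: sum.reindex[OF inj])
    qed
    also have "\<dots> = (\<Sum>G\<in>{G\<in>?L. F \<subseteq> G}. ?T F G * kl_poly (contraction M G))"
      by (intro sum.cong refl) (simp add: contraction_contraction[OF assms(1) _ flatsD])
    finally show "reverse_poly (rk M) (monom 1 (rk (restriction M F)) * kl_poly ?N) =
        (\<Sum>G\<in>?L. if F \<subseteq> G then ?T F G * kl_poly (contraction M G) else 0)"
      using finL by (simp flip: sum.inter_filter)
  qed
  also have "\<dots> = (\<Sum>G\<in>?L. \<Sum>F\<in>?L. if F \<subseteq> G then ?T F G * kl_poly (contraction M G) else 0)"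
    by (rule sum.swap)
  also have "\<dots> = (\<Sum>G\<in>?L. monom 1 (rk (restriction M G)) * kl_poly (contraction M G))"
  proof (rule sum.cong[OF refl])
    fix G assume G: "G \<in> ?L"
    have "(\<Sum>F\<in>?L. if F \<subseteq> G then ?T F G * kl_poly (contraction M G) else 0) =
        (\<Sum>F\<in>{F\<in>?L. F \<subseteq> G}. ?T F G) * kl_poly (contraction M G)"
      using finL by (simp add: sum_distrib_right flip: sum.inter_filter)
    then show "(\<Sum>F\<in>?L. if F \<subseteq> G then ?T F G * kl_poly (contraction M G) else 0) =
        monom 1 (rk (restriction M G)) * kl_poly (contraction M G)"
      by (simp add: sum_char_poly_interval[OF assms G] rk_restriction)
  qed
  finally show ?thesis by (simp add: z_poly_def)
qed

section \<open>Ranks, flats and contractions of uniform matroids\<close>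

lemma rank_of_uniform_matroid:
  assumes "finite E" "A \<subseteq> E"
  shows "rank_of (uniform_matroid E d) A = min (card A) d"
proof (rule antisym)
  let ?U = "uniform_matroid E d"
  note U = matroid_uniform_matroid[OF assms(1), of d]
  have finA: "finite A" using assms finite_subset by blast
  obtain I where "I \<in> indep ?U" "I \<subseteq> A" "card I = rank_of ?U A" using rank_of_attained[OF U] .
  then show "rank_of ?U A \<le> min (card A) d"
    using card_mono[OF finA, of I] by (simp add: uniform_matroid_def)
  obtain J where J: "J \<subseteq> A" "card J = min (card A) d"
    using obtain_subset_with_card_n[of "min (card A) d" A] by (metis min.cobounded1)
  then have "J \<in> indep ?U" using assms(2) by (auto simp: uniform_matroid_def)
  then show "min (card A) d \<le> rank_of ?U A" using card_le_rank_of[OF U _ J(1)] J(2) by simp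
qed

lemma flats_uniform_matroid:
  assumes "finite E" "d \<le> card E"
  shows "flats (uniform_matroid E d) = insert E {F. F \<subseteq> E \<and> card F < d}"
proof -
  let ?U = "uniform_matroid E d"
  have g: "ground ?U = E" by (simp add: uniform_matroid_def)
  have "(\<forall>x\<in>E - F. rank_of ?U F < rank_of ?U (insert x F)) \<longleftrightarrow> F = E \<or> card F < d"
    if F: "F \<subseteq> E" for F
  proof -
    have fin: "finite F" using F assms(1) finite_subset by blast
    have "rank_of ?U F < rank_of ?U (insert x F) \<longleftrightarrow> card F < d" if "x \<in> E - F" for x
      using that F fin rank_of_uniform_matroid[OF assms(1), of F d]
        rank_of_uniform_matroid[OF assms(1), of "insert x F" d] by auto
    then show ?thesis using F by blast
  qed
  then show ?thesis unfolding flats_def g by blast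
qed

lemma contraction_uniform_matroid:
  assumes "finite E" "F \<subseteq> E" "card F \<le> d"
  shows "contraction (uniform_matroid E d) F = uniform_matroid (E - F) (d - card F)"
proof -
  let ?U = "uniform_matroid E d"
  note U = matroid_uniform_matroid[OF assms(1), of d]
  have b: "basis_of ?U F F"
  proof (rule basis_ofI[OF U])
    show "F \<in> indep ?U" using assms by (simp add: uniform_matroid_def)
    show "card F = rank_of ?U F" using assms by (simp add: rank_of_uniform_matroid)
  qed simp
  have "I \<in> indep (contraction ?U F) \<longleftrightarrow> I \<in> indep (uniform_matroid (E - F) (d - card F))" for I
  proof (cases "I \<subseteq> E - F")
    case True
    then have "card (I \<union> F) = card I + card F"
      using assms finite_subset by (intro card_Un_disjoint) blast+
    then show ?thesis
      unfolding indep_contraction_iff[OF U b] using True assms(2,3) by (auto simp: uniform_matroid_def)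
  next
    case False
    then show ?thesis
      unfolding indep_contraction_iff[OF U b] by (auto simp: uniform_matroid_def)
  qed
  then show ?thesis by (intro set_system.equality) (auto simp: uniform_matroid_def)
qed

lemma sum_subsets_by_card:
  fixes g :: "nat \<Rightarrow> 'b::comm_semiring_1"
  assumes "finite E"
  shows "(\<Sum>F\<in>{F. F \<subseteq> E \<and> card F < d}. g (card F)) = (\<Sum>k<d. of_nat (card E choose k) * g k)"
proof -
  let ?S = "{F. F \<subseteq> E \<and> card F < d}"
  have fin: "finite ?S" using assms by (auto intro: finite_subset[of _ "Pow E"])
  have "(\<Sum>F\<in>?S. g (card F)) = (\<Sum>k<d. \<Sum>F\<in>{F\<in>?S. card F = k}. g (card F))"
    by (rule sum.group[OF fin, symmetric]) auto
  also have "\<dots> = (\<Sum>k<d. of_nat (card E choose k) * g k)"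
  proof (rule sum.cong[OF refl])
    fix k assume "k \<in> {..<d}"
    then have "{F\<in>?S. card F = k} = {F. F \<subseteq> E \<and> card F = k}" by auto
    then show "(\<Sum>F\<in>{F\<in>?S. card F = k}. g (card F)) = of_nat (card E choose k) * g k"
      using n_subsets[OF assms, of k] by (simp add: sum_constant)
  qed
  finally show ?thesis .
qed

text \<open>In \<open>kl_coeff m i j\<close> and \<open>z_coeff m i j\<close> the index \<open>i\<close> is the power of \<open>t\<close> and \<open>j = d - i\<close>.
  Write \<open>N = m + i + j\<close>. In terms of \<open>F = \<Sum> z_coeff m i j x\<^sup>i y\<^sup>j / N!\<close>, the degree bound on \<open>P\<close> says
  that \<open>e\<^sup>-\<^sup>x F\<close> has only terms with \<open>i < j\<close> apart from \<open>j = 0\<close>. By the symmetry of \<open>F\<close> the coefficient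
  of \<open>x\<^sup>k y\<^sup>l\<close> in \<open>e\<^sup>-\<^sup>x\<^sup>-\<^sup>y F\<close> then comes from the row \<open>l = 0\<close> if \<open>k \<ge> l\<close> and from the column \<open>k = 0\<close>
  otherwise, which gives \<open>(-1)\<^sup>k\<^sup>+\<^sup>l / ((m - 1)! k! l! (m + max k l))\<close>.\<close>

definition kl_coeff :: "nat \<Rightarrow> nat \<Rightarrow> nat \<Rightarrow> real" where
  "kl_coeff m i j = fact (m + i + j) / (fact (m - 1) * fact i * fact j) *
     ((-1) ^ i * (\<Sum>l\<le>j. (-1) ^ l * real (j choose l) / real (m + max i l)))"

definition z_coeff :: "nat \<Rightarrow> nat \<Rightarrow> nat \<Rightarrow> real" where
  "z_coeff m i j = fact (m + i + j) / (fact (m - 1) * fact i * fact j) *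
     (\<Sum>k\<le>i. \<Sum>l\<le>j. (-1) ^ (k + l) * real (i choose k) * real (j choose l) / real (m + max k l))"

section \<open>Degree bound, symmetry and convolution for the closed forms\<close>

text \<open>For \<open>j <= i\<close> the maximum is constantly \<open>i\<close>, so a full
  alternating row of binomial coefficients factors out, and it sums to 0 since \<open>j > 0\<close>.
  This is the degree bound on P, read off the closed form.\<close>

lemma kl_coeff_eq_0:
  assumes "0 < j" "j \<le> i"
  shows "kl_coeff m i j = 0"
proof -
  have "(\<Sum>l\<le>j. (-1) ^ l * real (j choose l) / real (m + max i l)) =
      (\<Sum>l\<le>j. (-1) ^ l * real (j choose l)) / real (m + i)"
    unfolding sum_divide_distrib using assms by (intro sum.cong refl) (simp add: max_absorb1)
  then show ?thesis
    using choose_alternating_sum[OF assms(1), where 'a = real] by (simp add: kl_coeff_def)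
qed

lemma z_coeff_commute: "z_coeff m i j = z_coeff m j i"
proof -
  let ?h = "\<lambda>i j k l. (-1) ^ (k + l) * real (i choose k) * real (j choose l) / real (m + max k l)"
  have "?h i j k l = ?h j i l k" for k l
    by (simp add: add.commute[of k l] max.commute[of k l])
  then have "(\<Sum>k\<le>i. \<Sum>l\<le>j. ?h i j k l) = (\<Sum>l\<le>j. \<Sum>k\<le>i. ?h j i l k)"
    by (subst sum.swap) (intro sum.cong refl)
  then show ?thesis by (simp add: z_coeff_def ac_simps)
qed

text \<open>In terms of exponential generating functions this is multiplication by the series of
  e^x, which undoes the factor e^(-x). The left side has the shape of the defining sum of Z, grouped
  by the size \<open>k\<close> of the flat.\<close>

lemma sum_choose_kl_coeff:
  "(\<Sum>k\<le>i. real ((m + i + j) choose k) * kl_coeff m (i - k) j) = z_coeff m i j"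
proof -
  let ?g = "\<lambda>k. \<Sum>l\<le>j. (-1) ^ l * real (j choose l) / real (m + max k l)"
  let ?c = "fact (m + i + j) / (fact (m - 1) * fact i * fact j) :: real"
  have "(\<Sum>k\<le>i. real ((m + i + j) choose k) * kl_coeff m (i - k) j) =
      (\<Sum>k\<le>i. ?c * (real (i choose (i - k)) * ((-1) ^ (i - k) * ?g (i - k))))"
  proof (rule sum.cong[OF refl])
    fix k assume "k \<in> {..i}"
    then have k: "k \<le> i" "m + (i - k) + j = m + i + j - k" "k \<le> m + i + j" by auto
    have "real ((m + i + j) choose k) * kl_coeff m (i - k) j =
        fact (m + i + j) / (fact k * fact (m + i + j - k)) *
        (fact (m + i + j - k) / (fact (m - 1) * fact (i - k) * fact j) * ((-1) ^ (i - k) * ?g (i - k)))"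
      unfolding kl_coeff_def k(2) using k(3) by (simp add: binomial_fact)
    also have "\<dots> = ?c * (fact i / (fact (i - k) * fact k)) * ((-1) ^ (i - k) * ?g (i - k))"
      by (simp add: field_simps)
    also have "fact i / (fact (i - k) * fact k) = real (i choose (i - k))"
      using k(1) by (simp add: binomial_fact)
    finally show "real ((m + i + j) choose k) * kl_coeff m (i - k) j =
        ?c * (real (i choose (i - k)) * ((-1) ^ (i - k) * ?g (i - k)))" by (simp add: mult.assoc)
  qed
  also have "\<dots> = (\<Sum>k\<le>i. ?c * (real (i choose k) * ((-1) ^ k * ?g k)))"
    by (rule sum.reindex_bij_witness[of _ "\<lambda>k. i - k" "\<lambda>k. i - k"]) auto
  also have "\<dots> = z_coeff m i j"
    unfolding z_coeff_def sum_distrib_left by (intro sum.cong refl) (simp add: power_add mult_ac)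
  finally show ?thesis .
qed

text \<open>Both sides are the Beta integral of x^(m-1) (1-x)^d over [0,1]. The induction uses
  Pascal's rule instead: the sum for \<open>Suc d\<close> at \<open>m\<close> is the sum for
  \<open>d\<close> at \<open>m\<close> minus the one at \<open>Suc m\<close>.\<close>

lemma alternating_sum_choose_divide:
  assumes "0 < m"
  shows "(\<Sum>l\<le>d. (-1) ^ l * real (d choose l) / real (m + l)) = fact (m - 1) * fact d / fact (m + d)"
  using assms
proof (induction d arbitrary: m)
  case 0
  then show ?case by (simp add: fact_reduce[of m])
next
  case (Suc d)
  have "(\<Sum>l\<le>Suc d. (-1) ^ l * real (Suc d choose l) / real (m + l)) =
      1 / real m + (\<Sum>l\<le>d. (-1) ^ Suc l * real (Suc d choose Suc l) / real (m + Suc l))"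
    by (subst sum.atMost_Suc_shift) simp
  also have "(\<Sum>l\<le>d. (-1) ^ Suc l * real (Suc d choose Suc l) / real (m + Suc l)) =
      (\<Sum>l\<le>d. (-1) ^ Suc l * real (d choose Suc l) / real (m + Suc l)) -
      (\<Sum>l\<le>d. (-1) ^ l * real (d choose l) / real (Suc m + l))"
    unfolding sum_subtractf[symmetric] 
    by (intro sum.cong refl) (simp add: add_divide_distrib diff_divide_distrib ring_distribs)
  also have "1 / real m + ((\<Sum>l\<le>d. (-1) ^ Suc l * real (d choose Suc l) / real (m + Suc l)) -
      (\<Sum>l\<le>d. (-1) ^ l * real (d choose l) / real (Suc m + l))) =
      (\<Sum>l\<le>Suc d. (-1) ^ l * real (d choose l) / real (m + l)) -
      (\<Sum>l\<le>d. (-1) ^ l * real (d choose l) / real (Suc m + l))"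
    by (subst sum.atMost_Suc_shift) simp
  also have "(\<Sum>l\<le>Suc d. (-1) ^ l * real (d choose l) / real (m + l)) =
      (\<Sum>l\<le>d. (-1) ^ l * real (d choose l) / real (m + l))"
    by simp
  also have "\<dots> = fact (m - 1) * fact d / fact (m + d)"
    using Suc by blast
  also have "(\<Sum>l\<le>d. (-1) ^ l * real (d choose l) / real (Suc m + l)) = fact m * fact d / fact (Suc (m + d))"
    using Suc.IH[of "Suc m"] by simp
  also have "fact (m - 1) * fact d / fact (m + d) - fact m * fact d / fact (Suc (m + d)) =
      (fact (m - 1) * fact (Suc d) / fact (m + Suc d) :: real)"
  proof -
    have f: "fact m = real m * fact (m - 1)" using Suc.prems by (simp add: fact_reduce)
    have "fact (Suc (m + d)) = real (Suc (m + d)) * fact (m + d)" by simp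
    then have "fact (m - 1) * fact d / fact (m + d) =
        (fact (m - 1) * fact d * real (Suc (m + d)) / fact (Suc (m + d)) :: real)"
      by (simp only:) simp
    then show ?thesis unfolding f by (simp add: diff_divide_distrib[symmetric] algebra_simps)
  qed
  finally show ?case .
qed

lemma z_coeff_0_left:
  assumes "0 < m"
  shows "z_coeff m 0 d = 1"
  using alternating_sum_choose_divide[OF assms, of d] by (simp add: z_coeff_def)

lemma z_coeff_0_right: "0 < m \<Longrightarrow> z_coeff m d 0 = 1"
  by (subst z_coeff_commute) (rule z_coeff_0_left)

section \<open>Identification of the coefficients of P and Z\<close>

text \<open>The flat \<open>E\<close> contributes t^d, and a flat with \<open>k < d\<close> elements
  contributes a shifted P of a uniform matroid of rank \<open>d - k\<close>. The coefficients of P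
  are left as a parameter \<open>c\<close>, so that the formula applies within an induction where P
  of the whole matroid (\<open>k = 0\<close>) is still unknown.\<close>

lemma coeff_z_poly_uniform_matroid_if_kl:
  assumes "finite E" "card E = m + d" "1 \<le> d"
    and "\<And>F i. F \<subseteq> E \<Longrightarrow> card F < d \<Longrightarrow> i \<le> d - card F \<Longrightarrow>
      of_int (coeff (kl_poly (uniform_matroid (E - F) (d - card F))) i) = (c (card F) i :: real)"
    and "n \<le> d"
  shows "of_int (coeff (z_poly (uniform_matroid E d)) n) =
    (if n = d then 1 else 0) + (\<Sum>k<d. real ((m + d) choose k) * (if n < k then 0 else c k (n - k)))"
proof -
  let ?U = "uniform_matroid E d" and ?S = "{F. F \<subseteq> E \<and> card F < d}"
  let ?t = "\<lambda>F. real_of_int (coeff (monom 1 (rk (restriction ?U F)) * kl_poly (contraction ?U F)) n)"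
  have U: "matroid ?U" "loopless ?U" "d \<le> card E"
    using assms matroid_uniform_matroid loopless_uniform_matroid by auto
  have flats: "flats ?U = insert E ?S" using flats_uniform_matroid[OF assms(1) U(3)] .
  have rkU: "rank_of ?U E = d" using rank_of_uniform_matroid[OF assms(1), of E d] U(3) by simp
  have "rk (contraction ?U E) = 0"
    using rank_of_add_rk_contraction[OF U(1), of E] rkU rk_uniform_matroid[OF assms(1) U(3)] flats by simp
  then have klE: "kl_poly (contraction ?U E) = 1"
    using kl_poly_rk_0[OF matroid_contraction[OF U(1)] loopless_contraction[OF U(1)]] flats by simp
  have finS: "finite ?S" using assms(1) by (auto intro: finite_subset[of _ "Pow E"])
  have "of_int (coeff (z_poly ?U) n) = (\<Sum>F\<in>insert E ?S. ?t F)"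
    by (simp only: z_poly_def coeff_sum of_int_sum flats)
  also have "\<dots> = ?t E + (\<Sum>F\<in>?S. ?t F)"
    using finS U(3) by (subst sum.insert) auto
  also have "?t E = (if n = d then 1 else 0)"
    using klE rkU by (simp add: rk_restriction)
  also have "(\<Sum>F\<in>?S. ?t F) = (\<Sum>F\<in>?S. if n < card F then 0 else c (card F) (n - card F))"
  proof (rule sum.cong[OF refl])
    fix F assume "F \<in> ?S"
    then have F: "F \<subseteq> E" "card F < d" by auto
    then have "rk (restriction ?U F) = card F"
      using rank_of_uniform_matroid[OF assms(1), of F d] by (simp add: rk_restriction)
    then show "?t F = (if n < card F then 0 else c (card F) (n - card F))"
      using F contraction_uniform_matroid[OF assms(1) F(1), of d] assms(4)[OF F, of "n - card F"] assms(5)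
      by (simp add: coeff_monom_mult diff_le_mono)
  qed
  also have "\<dots> = (\<Sum>k<d. real (card E choose k) * (if n < k then 0 else c k (n - k)))"
    by (rule sum_subsets_by_card[OF assms(1)])
  finally show ?thesis by (simp add: assms(2))
qed

lemma sum_if_less_eq_z_coeff:
  assumes "n < d"
  shows "(\<Sum>k<d. real ((m + d) choose k) * (if n < k then 0 else kl_coeff m (n - k) (d - n))) =
    z_coeff m n (d - n)"
proof -
  have "(\<Sum>k<d. real ((m + d) choose k) * (if n < k then 0 else kl_coeff m (n - k) (d - n))) =
      (\<Sum>k\<le>n. real ((m + n + (d - n)) choose k) * kl_coeff m (n - k) (d - n))"
    using assms by (intro sum.mono_neutral_cong_right) auto
  then show ?thesis by (simp only: sum_choose_kl_coeff)
qed

text \<open>Strong induction on the rank. From the middle degree on, the degree bound gives 0 on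
  both sides. Below it, palindromicity of Z compares the coefficient at \<open>i\<close> with the
  one at \<open>d - i\<close>, where the unknown P does not contribute.\<close>

lemma coeff_kl_poly_uniform_matroid:
  assumes "0 < m" "1 \<le> d" "finite E" "card E = m + d" "i \<le> d"
  shows "of_int (coeff (kl_poly (uniform_matroid E d)) i) =
    (if i < d then kl_coeff m i (d - i) else 0)"
  using assms(2-)
proof (induction d arbitrary: E i rule: less_induct)
  case (less d)
  let ?U = "uniform_matroid E d"
  have dE: "d \<le> card E" using less.prems by simp
  have U: "matroid ?U" "loopless ?U" "rk ?U = d"
    using less.prems matroid_uniform_matroid loopless_uniform_matroid rk_uniform_matroid[OF _ dE] by auto
  have deg: "2 * degree (kl_poly ?U) < d"
    using degree_kl_poly[OF U(1,2)] U(3) less.prems(1) by simp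
  \<comment> \<open>Contractions by nonempty flats are known by induction; the entry
    \<open>k = 0\<close> stays the true coefficient of P, the only unknown.\<close>
  define c where "c k i = (if k = 0 then of_int (coeff (kl_poly ?U) i)
      else if i < d - k then kl_coeff m i (d - k - i) else 0)" for k i
  have c: "of_int (coeff (kl_poly (uniform_matroid (E - F) (d - card F))) i) = c (card F) i"
    if F: "F \<subseteq> E" "card F < d" and i: "i \<le> d - card F" for F i
  proof (cases "F = {}")
    case False
    have "finite F" using F less.prems(2) finite_subset by blast
    then have "0 < card F" "card (E - F) = m + (d - card F)"
      using False F less.prems by (auto simp: card_Diff_subset card_gt_0_iff)
    then show ?thesis using less.IH[of "d - card F" "E - F" i] F i less.prems(1,2) by (simp add: c_def)
  qed (simp add: c_def)
  note z = coeff_z_poly_uniform_matroid_if_kl[OF less.prems(2,3,1) c]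
  have c_eq: "c k (n - k) = (if n < d then kl_coeff m (n - k) (d - n) else 0)"
    if "0 < k" "k \<le> n" "n \<le> d" for k n
    using that by (auto simp: c_def)
  show ?case
  proof (cases "2 * i < d")
    case False
    then have "coeff (kl_poly ?U) i = 0" using deg by (simp add: coeff_eq_0)
    moreover have "kl_coeff m i (d - i) = 0" if "i < d"
      using that False by (intro kl_coeff_eq_0) auto
    ultimately show ?thesis by simp
  next
    case True
    let ?n = "d - i"
    \<comment> \<open>The unknown enters only through the term \<open>k = 0\<close>, so Z misses its
      closed form by exactly the error of P.\<close>
    have zi: "of_int (coeff (z_poly ?U) i) =
        z_coeff m i (d - i) + (of_int (coeff (kl_poly ?U) i) - kl_coeff m i (d - i))"
    proof -
      have "of_int (coeff (z_poly ?U) i) = (\<Sum>k<d. real ((m + d) choose k) * (if i < k then 0 else c k (i - k)))"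
        using z[of i] True by simp
      also have "\<dots> = (\<Sum>k<d. real ((m + d) choose k) * (if i < k then 0 else kl_coeff m (i - k) (d - i)) +
          (if k = 0 then of_int (coeff (kl_poly ?U) i) - kl_coeff m i (d - i) else 0))"
      proof (rule sum.cong[OF refl])
        fix k assume "k \<in> {..<d}"
        show "real ((m + d) choose k) * (if i < k then 0 else c k (i - k)) =
            real ((m + d) choose k) * (if i < k then 0 else kl_coeff m (i - k) (d - i)) +
            (if k = 0 then of_int (coeff (kl_poly ?U) i) - kl_coeff m i (d - i) else 0)"
          using c_eq[of k i] True by (cases "k = 0") (auto simp: c_def)
      qed
      also have "\<dots> = z_coeff m i (d - i) + (of_int (coeff (kl_poly ?U) i) - kl_coeff m i (d - i))"
        using True sum_if_less_eq_z_coeff[of i d m] by (simp add: sum.distrib)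
      finally show ?thesis .
    qed
    \<comment> \<open>At the mirrored index the degree bound makes the coefficient of P vanish, in
      agreement with the closed form, so there is no error on that side.\<close>
    have ck: "c k (?n - k) = (if ?n < d then kl_coeff m (?n - k) (d - ?n) else 0)" if "k \<le> ?n" for k
    proof (cases "k = 0")
      case True
      have "coeff (kl_poly ?U) ?n = 0" using deg \<open>2 * i < d\<close> by (intro coeff_eq_0) auto
      moreover have "kl_coeff m ?n (d - ?n) = 0" if "?n < d"
        using that \<open>2 * i < d\<close> by (intro kl_coeff_eq_0) auto
      ultimately show ?thesis using True by (simp add: c_def)
    next
      case False
      then show ?thesis using c_eq[of k ?n] that by simp
    qed
    have "of_int (coeff (z_poly ?U) ?n) = z_coeff m ?n (d - ?n)"
    \<comment> \<open>For \<open>i = 0\<close> the mirrored index is \<open>d\<close>, where only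
      the flat \<open>E\<close> contributes.\<close>
    proof (cases "i = 0")
      case True
      have "(\<Sum>k<d. real ((m + d) choose k) * (if ?n < k then 0 else c k (?n - k))) = 0"
        using ck True by (intro sum.neutral) auto
      then show ?thesis using z[of ?n] True z_coeff_0_right[OF assms(1)] by simp
    next
      case False
      then have lt: "?n < d" using True by simp
      have "(\<Sum>k<d. real ((m + d) choose k) * (if ?n < k then 0 else c k (?n - k))) =
          (\<Sum>k<d. real ((m + d) choose k) * (if ?n < k then 0 else kl_coeff m (?n - k) (d - ?n)))"
        using ck lt by (intro sum.cong) auto
      then show ?thesis using z[of ?n] lt sum_if_less_eq_z_coeff[OF lt, of m] by simp
    qed
    moreover have "d - ?n = i" using True by simp
    moreover have "coeff (z_poly ?U) ?n = coeff (z_poly ?U) i"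
      using arg_cong[OF z_poly_palindromic[OF U(1,2)], of "\<lambda>p. coeff p i"] True U(3)
      by (simp add: coeff_reverse_poly)
    ultimately show ?thesis using zi z_coeff_commute[of m i ?n] True by simp
  qed
qed

text \<open>Z equals its own reversal, and a reversal has no coefficients above the rank.\<close>

lemma degree_z_poly_le:
  assumes "matroid M" "loopless M"
  shows "degree (z_poly M) \<le> rk M"
  by (rule degree_le, subst z_poly_palindromic[OF assms, symmetric]) (simp add: coeff_reverse_poly)

lemma coeff_z_poly_uniform_matroid:
  assumes "0 < m" "1 \<le> d" "finite E" "card E = m + d" "i \<le> d"
  shows "of_int (coeff (z_poly (uniform_matroid E d)) i) = z_coeff m i (d - i)"
proof -
  define c where "c k i = (if i < d - k then kl_coeff m i (d - k - i) else 0)" for k i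
  have c: "of_int (coeff (kl_poly (uniform_matroid (E - F) (d - card F))) i) = c (card F) i"
    if F: "F \<subseteq> E" "card F < d" and i: "i \<le> d - card F" for F i
  proof -
    have "finite F" using F assms(3) finite_subset by blast
    then have "card (E - F) = m + (d - card F)"
      using F assms(4) by (simp add: card_Diff_subset)
    then show ?thesis
      using coeff_kl_poly_uniform_matroid[OF assms(1), of "d - card F" "E - F" i] F i assms(3) by (simp add: c_def)
  qed
  note z = coeff_z_poly_uniform_matroid_if_kl[OF assms(3,4,2) c assms(5)]
  show ?thesis
  proof (cases "i = d")
    case True
    have "(\<Sum>k<d. real ((m + d) choose k) * (if i < k then 0 else c k (i - k))) = 0"
      using True by (intro sum.neutral) (auto simp: c_def)
    then show ?thesis using z True z_coeff_0_right[OF assms(1)] by simp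
  next
    case False
    then have lt: "i < d" using assms(5) by simp
    have "(\<Sum>k<d. real ((m + d) choose k) * (if i < k then 0 else c k (i - k))) =
        (\<Sum>k<d. real ((m + d) choose k) * (if i < k then 0 else kl_coeff m (i - k) (d - i)))"
      using lt by (intro sum.cong) (auto simp: c_def)
    then show ?thesis using z lt sum_if_less_eq_z_coeff[OF lt, of m] by simp
  qed
qed

section \<open>Partial sums of Gauss's series\<close>

text \<open>For \<open>s = i j\<close> and \<open>d = i + j\<close> we have \<open>s + l (d + l) = (i + l) (j + l)\<close>, so that \<open>gauss_term d k\<close>
  is the \<open>k\<close>-th term of Gauss's series \<open>F(i, j; 1; 1)\<close>, seen as a polynomial in \<open>s\<close>.\<close>

definition gauss_term :: "nat \<Rightarrow> nat \<Rightarrow> real poly" where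
  "gauss_term d k = smult (1 / (fact k)\<^sup>2) (\<Prod>l<k. [:real l * (real d + real l), 1:])"

definition gauss_sum :: "nat \<Rightarrow> nat \<Rightarrow> real poly" where
  "gauss_sum d n = (\<Sum>k\<le>n. gauss_term d k)"

definition gauss_double_sum :: "nat \<Rightarrow> nat \<Rightarrow> real poly" where
  "gauss_double_sum d m = (\<Sum>n<m. gauss_sum d n)"

lemma poly_gauss_term:
  "poly (gauss_term d k) s = (\<Prod>l<k. s + real l * (real d + real l)) / (fact k)\<^sup>2"
  by (simp add: gauss_term_def poly_prod add.commute)

lemma poly_gauss_term_Suc:
  "(real (Suc k))\<^sup>2 * poly (gauss_term d (Suc k)) s = (s + real k * (real d + real k)) * poly (gauss_term d k) s"
proof -
  have "(fact (Suc k))\<^sup>2 = (real (Suc k))\<^sup>2 * (fact k)\<^sup>2"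
    by (simp only: fact_Suc power_mult_distrib)
  moreover have "(real (Suc k))\<^sup>2 \<noteq> 0" by simp
  ultimately show ?thesis
    unfolding poly_gauss_term prod.lessThan_Suc by (simp only: times_divide_eq_right mult_divide_mult_cancel_left) simp
qed

lemma gauss_sum_Suc: "gauss_sum d (Suc n) = gauss_sum d n + gauss_term d (Suc n)"
  by (simp add: gauss_sum_def)

text \<open>Summation by parts: in the induction step the inner sum is rewritten as the next one
  minus its last term, and the terms then combine by the ratio
  \<open>poly_gauss_term_Suc\<close>.\<close>

lemma gauss_double_sum_eq:
  "real d * poly (gauss_double_sum d (Suc n)) s =
    (real (Suc n) * real d + s) * poly (gauss_sum d n) s - (real (Suc n))\<^sup>2 * poly (gauss_term d (Suc n)) s"
proof (induction n)
  case 0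
  show ?case
    by (simp add: gauss_double_sum_def gauss_sum_def gauss_term_def)
next
  case (Suc n)
  let ?S = "\<lambda>n. poly (gauss_sum d n) s" and ?u = "\<lambda>k. poly (gauss_term d k) s"
  have "real d * poly (gauss_double_sum d (Suc (Suc n))) s =
      real d * poly (gauss_double_sum d (Suc n)) s + real d * ?S (Suc n)"
    by (simp add: gauss_double_sum_def algebra_simps)
  also have "\<dots> = (real (Suc n) * real d + s) * ?S n - (real (Suc n))\<^sup>2 * ?u (Suc n) + real d * ?S (Suc n)"
    by (simp only: Suc.IH)
  also have "?S n = ?S (Suc n) - ?u (Suc n)" by (simp add: gauss_sum_Suc)
  also have "(real (Suc n) * real d + s) * (?S (Suc n) - ?u (Suc n)) - (real (Suc n))\<^sup>2 * ?u (Suc n) + real d * ?S (Suc n) =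
      (real (Suc (Suc n)) * real d + s) * ?S (Suc n) - (s + real (Suc n) * (real d + real (Suc n))) * ?u (Suc n)"
    by (simp add: algebra_simps power2_eq_square)
  finally show ?case by (simp only: poly_gauss_term_Suc)
qed

text \<open>At \<open>s = - b (d + b)\<close> the quantity \<open>s + l (d + l)\<close> splits as
  \<open>(b - l) (- (d + b) - l)\<close>, so the product is one of two falling factorials.\<close>

lemma poly_gauss_term_node:
  "poly (gauss_term d k) (- (real b * (real d + real b))) = (real b gchoose k) * ((- real (d + b)) gchoose k)"
proof -
  have "(\<Prod>l<k. - (real b * (real d + real b)) + real l * (real d + real l)) =
      (\<Prod>l<k. (real b - real l) * (- real (d + b) - real l))"
    by (intro prod.cong refl) (simp add: algebra_simps)
  then show ?thesis
    by (simp add: poly_gauss_term gbinomial_prod_rev prod.distrib power2_eq_square atLeast0LessThan)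
qed

text \<open>The points \<open>- b (d + b)\<close> turn the truncated hypergeometric sum into a terminating one, which
  the Chu--Vandermonde identity evaluates.\<close>

lemma poly_gauss_sum_node:
  assumes "b \<le> n" "1 \<le> d"
  shows "poly (gauss_sum d n) (- (real b * (real d + real b))) = (-1) ^ b * real ((d + b - 1) choose b)"
proof -
  have "poly (gauss_sum d n) (- (real b * (real d + real b))) =
      (\<Sum>k\<le>n. (real b gchoose k) * ((- real (d + b)) gchoose k))"
    by (simp add: gauss_sum_def poly_sum poly_gauss_term_node)
  \<comment> \<open>Terms beyond \<open>b\<close> vanish, and the symmetry of the first binomial
    coefficient gives the shape of Vandermonde's identity.\<close>
  also have "\<dots> = (\<Sum>k\<in>{0..b}. ((- real (d + b)) gchoose k) * (real b gchoose (b - k)))"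
  proof (rule sum.mono_neutral_cong_right)
    show "\<forall>k\<in>{..n} - {0..b}. (real b gchoose k) * ((- real (d + b)) gchoose k) = 0"
      by (auto simp: binomial_gbinomial[symmetric])
    show "(real b gchoose k) * ((- real (d + b)) gchoose k) = ((- real (d + b)) gchoose k) * (real b gchoose (b - k))"
      if "k \<in> {0..b}" for k
      using that by (simp add: binomial_gbinomial[symmetric] binomial_symmetric[of k b])
  qed (use assms in auto)
  also have "\<dots> = (- real d) gchoose b"
    by (simp add: gbinomial_Vandermonde)
  also have "\<dots> = (-1) ^ b * real ((d + b - 1) choose b)"
    using assms(2) by (simp add: gbinomial_minus binomial_gbinomial of_nat_diff)
  finally show ?thesis .
qed

section \<open>Zeros located by sign changes\<close>

lemma alternating_signs_imp_roots:
  fixes p :: "real poly"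
  assumes "\<And>b. b < n \<Longrightarrow> x (Suc b) < x b" "\<And>b. b \<le> n \<Longrightarrow> 0 < (-1) ^ b * poly p (x b)"
  obtains y where "\<And>b. b < n \<Longrightarrow> x (Suc b) < y b \<and> y b < x b \<and> poly p (y b) = 0"
proof -
  have "\<exists>y. x (Suc b) < y \<and> y < x b \<and> poly p y = 0" if b: "b < n" for b
  proof (cases "even b")
    case True
    then show ?thesis
      using assms(1)[OF b] assms(2)[of b] assms(2)[of "Suc b"] b by (intro poly_IVT_pos) auto
  next
    case False
    then show ?thesis
      using assms(1)[OF b] assms(2)[of b] assms(2)[of "Suc b"] b by (intro poly_IVT_neg) auto
  qed
  then show ?thesis using that by metis
qed

text \<open>The difference of the two sides has its coefficient at \<open>n\<close> cancelled, hence
  degree below \<open>n\<close>, but it vanishes at \<open>n\<close> distinct points. With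
  \<open>coeff p n\<close> as the constant an upper bound on the degree suffices.\<close>

lemma poly_eq_prod_distinct_roots:
  fixes p :: "'a::field poly"
  assumes "degree p \<le> n" "inj_on y {..<n}" "\<And>b. b < n \<Longrightarrow> poly p (y b) = 0"
  shows "p = smult (coeff p n) (\<Prod>b<n. [:- y b, 1:])"
proof (rule ccontr)
  let ?P = "\<Prod>b<n. [:- y b, 1:]"
  let ?q = "p - smult (coeff p n) ?P"
  assume "p \<noteq> smult (coeff p n) ?P"
  then have q: "?q \<noteq> 0" by simp
  have dP: "degree ?P = n" by (subst degree_prod_eq_sum_degree) auto
  moreover have "lead_coeff ?P = 1" by (simp add: lead_coeff_prod)
  ultimately have "coeff ?q n = 0" by simp
  moreover have "degree ?q \<le> n" using assms(1) dP by (intro degree_diff_le) auto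
  ultimately have lt: "degree ?q < n"
    using q by (metis le_neq_implies_less leading_coeff_0_iff)
  have "y ` {..<n} \<subseteq> {x. poly ?q x = 0}"
    using assms(3) by (auto simp: poly_prod)
  then have "card (y ` {..<n}) \<le> degree ?q"
    using card_mono[OF poly_roots_finite[OF q]] card_poly_roots_bound[OF q] le_trans by blast
  then show False using lt card_image[OF assms(2)] by simp
qed

lemma degree_gauss_sum_le: "degree (gauss_sum d n) \<le> n"
  unfolding gauss_sum_def gauss_term_def
proof (rule degree_sum_le)
  fix k assume "k \<in> {..n}"
  then show "degree (smult (1 / (fact k)\<^sup>2) (\<Prod>l<k. [:real l * (real d + real l), 1:])) \<le> n"
    by (simp add: degree_prod_eq_sum_degree)
qed simp

text \<open>The zeros of \<open>gauss_sum d n\<close> separate those of \<open>gauss_double_sum d (Suc n)\<close>, because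
  \<open>gauss_double_sum_eq\<close> leaves only the factored \<open>gauss_term d (Suc n)\<close> at such a zero.\<close>

lemma gauss_double_sum_factorization:
  assumes "1 \<le> d"
  obtains c \<beta> where "\<And>b. b < n \<Longrightarrow> (0::real) < \<beta> b"
    "gauss_double_sum d (Suc n) = smult c (\<Prod>b<n. [:\<beta> b, 1:])"
proof -
  let ?R = "gauss_double_sum d (Suc n)"
  define e where "e b = real b * (real d + real b)" for b
  have mono_e: "e b < e b'" if "b < b'" for b b'
    unfolding e_def using that assms by (intro mult_strict_mono) auto
  \<comment> \<open>The nodes \<open>- e b\<close> carry alternating signs of
    \<open>gauss_sum d n\<close>, so each gap between neighbours contains a zero.\<close>
  obtain \<sigma> where \<sigma>: "\<And>b. b < n \<Longrightarrow> - e (Suc b) < \<sigma> b \<and> \<sigma> b < - e b \<and> poly (gauss_sum d n) (\<sigma> b) = 0"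
  proof (rule alternating_signs_imp_roots[of n "\<lambda>b. - e b" "gauss_sum d n"])
    show "0 < (-1) ^ b * poly (gauss_sum d n) (- e b)" if "b \<le> n" for b
      using poly_gauss_sum_node[OF that assms] assms by (simp add: e_def power_add[symmetric] mult.assoc[symmetric])
  qed (use mono_e in auto)
  have dR: "real d * ((-1) ^ b * poly ?R s) = (-1) ^ b * ((real (Suc n) * real d + s) * poly (gauss_sum d n) s -
      (real (Suc n))\<^sup>2 * poly (gauss_term d (Suc n)) s)" for b s
    by (simp only: gauss_double_sum_eq[symmetric] mult.left_commute)
  have pos: "0 < (-1) ^ b * poly ?R s" if "0 < real d * ((-1) ^ b * poly ?R s)" for b s
    using that assms by (simp add: zero_less_mult_iff)
  \<comment> \<open>At this zero only the term with the factors \<open>s + e l\<close> survives.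
    Exactly the \<open>b + 1\<close> factors with \<open>l <= b\<close> are negative, and the minus
    sign in front leaves \<open>(-1) ^ b\<close>.\<close>
  have sign_\<sigma>: "0 < (-1) ^ b * poly ?R (\<sigma> b)" if b: "b < n" for b
  proof (rule pos)
    have "(\<Prod>l<Suc n. \<sigma> b + e l) = (\<Prod>l<Suc b. \<sigma> b + e l) * (\<Prod>l=Suc b..<Suc n. \<sigma> b + e l)"
      using prod.atLeastLessThan_concat[of 0 "Suc b" "Suc n" "\<lambda>l. \<sigma> b + e l"] b
      by (simp only: atLeast0LessThan)
    also have "(\<Prod>l<Suc b. \<sigma> b + e l) = (-1) ^ Suc b * (\<Prod>l<Suc b. - (\<sigma> b + e l))"
      by (simp only: prod_uminus card_lessThan mult.assoc[symmetric] power_add[symmetric]) simp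
    finally have "(-1) ^ b * - (\<Prod>l<Suc n. \<sigma> b + e l) =
        (\<Prod>l<Suc b. - (\<sigma> b + e l)) * (\<Prod>l=Suc b..<Suc n. \<sigma> b + e l)"
      by (simp only: mult.assoc) (cases "even b"; simp)
    moreover have "0 < (\<Prod>l<Suc b. - (\<sigma> b + e l))"
    proof (rule prod_pos)
      fix l assume "l \<in> {..<Suc b}"
      then have "e l \<le> e b" using mono_e[of l b] by (cases "l = b") auto
      then show "0 < - (\<sigma> b + e l)" using \<sigma>[OF b] by simp
    qed
    moreover have "0 < (\<Prod>l=Suc b..<Suc n. \<sigma> b + e l)"
    proof (rule prod_pos)
      fix l assume "l \<in> {Suc b..<Suc n}"
      then have "e (Suc b) \<le> e l" using mono_e[of "Suc b" l] by (cases "l = Suc b") auto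
      then show "0 < \<sigma> b + e l" using \<sigma>[OF b] by simp
    qed
    ultimately have "0 < (-1) ^ b * - (\<Prod>l<Suc n. \<sigma> b + e l)" by simp
    then have "0 < (real (Suc n))\<^sup>2 / (fact (Suc n))\<^sup>2 * ((-1) ^ b * - (\<Prod>l<Suc n. \<sigma> b + e l))"
      by (rule mult_pos_pos[rotated]) simp
    also have "\<dots> = real d * ((-1) ^ b * poly ?R (\<sigma> b))"
      unfolding dR using \<sigma>[OF b] by (simp only: poly_gauss_term e_def) simp
    finally show "0 < real d * ((-1) ^ b * poly ?R (\<sigma> b))" .
  qed
  \<comment> \<open>One more test point to the left of all \<open>\<sigma> b\<close>. There the
    factor \<open>(n + 1) d + s\<close> equals \<open>- (n + 1)^2\<close>, so the identity collapses
    to a negative multiple of \<open>gauss_sum d (Suc n)\<close>, whose sign at this node is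
    known.\<close>
  have sign_e: "0 < (-1) ^ n * poly ?R (- e (Suc n))"
  proof (rule pos)
    have "real (Suc n) * real d + - e (Suc n) = - (real (Suc n))\<^sup>2"
      by (simp add: e_def algebra_simps power2_eq_square)
    then have "real d * ((-1) ^ n * poly ?R (- e (Suc n))) =
        (-1) ^ Suc n * ((real (Suc n))\<^sup>2 * poly (gauss_sum d (Suc n)) (- e (Suc n)))"
      unfolding dR gauss_sum_Suc by (simp only: poly_add) (simp add: algebra_simps)
    also have "poly (gauss_sum d (Suc n)) (- e (Suc n)) = (-1) ^ Suc n * real ((d + Suc n - 1) choose Suc n)"
      unfolding e_def using poly_gauss_sum_node[of "Suc n" "Suc n" d] assms by blast
    also have "(-1) ^ Suc n * ((real (Suc n))\<^sup>2 * ((-1) ^ Suc n * real ((d + Suc n - 1) choose Suc n))) =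
        (real (Suc n))\<^sup>2 * real ((d + Suc n - 1) choose Suc n)"
      by (simp add: power_add[symmetric] mult.assoc[symmetric])
    also have "\<dots> > 0" using assms by simp
    finally show "0 < real d * ((-1) ^ n * poly ?R (- e (Suc n)))" .
  qed
  \<comment> \<open>These \<open>n + 1\<close> points with alternating signs yield \<open>n\<close>
    zeros, as many as the degree allows.\<close>
  define x where "x b = (if b < n then \<sigma> b else - e (Suc n))" for b
  have x_less: "x (Suc b) < x b" if "b < n" for b
  proof (cases "Suc b < n")
    case True
    then show ?thesis using \<sigma>[of b] \<sigma>[of "Suc b"] by (simp add: x_def)
  next
    case False
    then have "n = Suc b" using that by simp
    then show ?thesis using \<sigma>[of b] mono_e[of n "Suc n"] by (simp add: x_def)
  qed
  obtain y where y: "\<And>b. b < n \<Longrightarrow> x (Suc b) < y b \<and> y b < x b \<and> poly ?R (y b) = 0"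
  proof (rule alternating_signs_imp_roots[of n x ?R])
    show "0 < (-1) ^ b * poly ?R (x b)" if "b \<le> n" for b
      using that sign_\<sigma>[of b] sign_e by (cases "b < n") (auto simp: x_def)
  qed (use x_less in auto)
  have y_less: "y b' < y b" if "b < b'" "b' < n" for b b'
    using that
  proof (induction b')
    case (Suc b')
    have "y (Suc b') < y b'" using y[of "Suc b'"] y[of b'] Suc.prems by simp
    then show ?case using Suc by (cases "b = b'") auto
  qed simp
  have "inj_on y {..<n}"
    by (rule linorder_inj_onI') (use y_less in fastforce)
  moreover have "degree ?R \<le> n"
    unfolding gauss_double_sum_def
    by (rule degree_sum_le) (auto intro: le_trans[OF degree_gauss_sum_le])
  ultimately have "?R = smult (coeff ?R n) (\<Prod>b<n. [:- y b, 1:])"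
    using y by (intro poly_eq_prod_distinct_roots) auto
  \<comment> \<open>Each zero lies to the left of \<open>\<sigma> b\<close>, which in turn lies to
    the left of \<open>- e b <= 0\<close>.\<close>
  moreover have "0 < - y b" if "b < n" for b
  proof -
    have "e 0 \<le> e b" using mono_e[of 0 b] by (cases "b = 0") auto
    moreover have "e 0 = 0" by (simp add: e_def)
    ultimately show ?thesis using y[OF that] \<sigma>[OF that] that by (simp add: x_def)
  qed
  ultimately show ?thesis using that[of "\<lambda>b. - y b" "coeff ?R n"] by blast
qed

section \<open>The coefficients in terms of Gauss's series\<close>

lemma Suc_times_choose_Suc: "Suc n * (c choose Suc n) = (c - n) * (c choose n)"
  using Suc_times_binomial_eq[of c n] binomial_absorb_comp[of "Suc c" "Suc n"] choose_reduce_nat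
  by (metis binomial_absorb_comp binomial_absorption times_binomial_minus1_eq mult.commute)

lemma alternating_sum_choose: "(\<Sum>k\<le>n. (-1) ^ k * real (Suc a choose k)) = (-1) ^ n * real (a choose n)"
  by (induction n) (simp_all add: algebra_simps)

text \<open>Abel summation along the level sets of the maximum.\<close>

lemma alternating_sum_max:
  fixes g :: "nat \<Rightarrow> real"
  shows "(\<Sum>k\<le>Suc a. \<Sum>l\<le>Suc b. (-1) ^ (k + l) * real (Suc a choose k) * real (Suc b choose l) * g (max k l)) =
    (\<Sum>n\<le>a. real (a choose n) * real (b choose n) * (g n - g (Suc n)))"
proof -
  define A B where "A k = (-1) ^ k * real (Suc a choose k)" and "B k = (-1) ^ k * real (Suc b choose k)" for k
  \<comment> \<open>A common summation bound beyond both rows, so that the complete alternating sums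
    of \<open>A\<close> and \<open>B\<close> vanish.\<close>
  define M where "M = Suc (a + b)"
  define h where "h n = g n - g (Suc n)" for n
  have SA: "(\<Sum>k\<le>n. A k) = (-1) ^ n * real (a choose n)" and SB: "(\<Sum>k\<le>n. B k) = (-1) ^ n * real (b choose n)" for n
    unfolding A_def B_def by (rule alternating_sum_choose)+
  have g: "g n = g (Suc M) + (\<Sum>i\<in>{n..M}. h i)" if "n \<le> M" for n
    using sum_Suc_diff[of n "M" g] that by (simp add: h_def sum_subtractf)
  \<comment> \<open>The condition that \<open>n\<close> is at least the maximum is the conjunction
    of one condition on \<open>k\<close> and one on \<open>l\<close>, so the double sum factors for
    each \<open>n\<close>.\<close>
  have gm: "g (max k l) = g (Suc M) + (\<Sum>n\<le>M. if k \<le> n \<and> l \<le> n then h n else 0)" if "k \<le> M" "l \<le> M" for k l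
  proof -
    have "(\<Sum>i\<in>{max k l..M}. h i) = (\<Sum>n\<le>M. if k \<le> n \<and> l \<le> n then h n else 0)"
      by (rule sum.mono_neutral_cong_left) auto
    then show ?thesis using g[of "max k l"] that by simp
  qed
  have "(\<Sum>k\<le>Suc a. \<Sum>l\<le>Suc b. (-1) ^ (k + l) * real (Suc a choose k) * real (Suc b choose l) * g (max k l)) =
      (\<Sum>k\<le>Suc a. \<Sum>l\<le>M. A k * B l * g (max k l))"
  proof (rule sum.cong[OF refl])
    fix k
    show "(\<Sum>l\<le>Suc b. (-1) ^ (k + l) * real (Suc a choose k) * real (Suc b choose l) * g (max k l)) =
        (\<Sum>l\<le>M. A k * B l * g (max k l))"
      by (rule sum.mono_neutral_cong_left) (auto simp: M_def A_def B_def power_add)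
  qed
  also have "\<dots> = (\<Sum>k\<le>M. \<Sum>l\<le>M. A k * B l * g (max k l))"
    by (rule sum.mono_neutral_left) (auto simp: M_def A_def binomial_eq_0 simp del: sum.atMost_Suc)
  also have "\<dots> = (\<Sum>k\<le>M. \<Sum>l\<le>M. A k * B l * g (Suc M) + (\<Sum>n\<le>M. if k \<le> n \<and> l \<le> n then A k * B l * h n else 0))"
    by (intro sum.cong refl) (simp add: gm distrib_left sum_distrib_left if_distrib cong: if_cong)
  also have "\<dots> = (\<Sum>k\<le>M. A k) * (\<Sum>l\<le>M. B l) * g (Suc M) +
      (\<Sum>k\<le>M. \<Sum>l\<le>M. \<Sum>n\<le>M. if k \<le> n \<and> l \<le> n then A k * B l * h n else 0)"
    by (simp only: sum.distrib sum_product flip: sum_distrib_right)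
  also have "(\<Sum>k\<le>M. A k) = 0" unfolding SA by (simp add: M_def binomial_eq_0)
  also have "(\<Sum>k\<le>M. \<Sum>l\<le>M. \<Sum>n\<le>M. if k \<le> n \<and> l \<le> n then A k * B l * h n else 0) =
      (\<Sum>k\<le>M. \<Sum>n\<le>M. \<Sum>l\<le>M. if k \<le> n \<and> l \<le> n then A k * B l * h n else 0)"
    by (intro sum.cong refl sum.swap)
  also have "\<dots> = (\<Sum>n\<le>M. \<Sum>k\<le>M. \<Sum>l\<le>M. if k \<le> n \<and> l \<le> n then A k * B l * h n else 0)"
    by (rule sum.swap)
  also have "\<dots> = (\<Sum>n\<le>M. real (a choose n) * real (b choose n) * h n)"
  proof (rule sum.cong[OF refl])
    fix n assume n: "n \<in> {..M}"
    have "(\<Sum>k\<le>M. \<Sum>l\<le>M. if k \<le> n \<and> l \<le> n then A k * B l * h n else 0) =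
        (\<Sum>k\<le>n. \<Sum>l\<le>M. if l \<le> n then A k * B l * h n else 0)"
      using n by (intro sum.mono_neutral_cong_right) auto
    also have "\<dots> = (\<Sum>k\<le>n. \<Sum>l\<le>n. A k * B l * h n)"
      using n by (intro sum.cong refl sum.mono_neutral_cong_right) auto
    also have "\<dots> = (\<Sum>k\<le>n. A k) * (\<Sum>l\<le>n. B l) * h n"
      by (simp only: sum_product flip: sum_distrib_right)
    also have "\<dots> = real (a choose n) * real (b choose n) * h n"
      unfolding SA SB by (simp add: power_add[symmetric] ac_simps)
    finally show "(\<Sum>k\<le>M. \<Sum>l\<le>M. if k \<le> n \<and> l \<le> n then A k * B l * h n else 0) =
        real (a choose n) * real (b choose n) * h n" .
  qed
  also have "\<dots> = (\<Sum>n\<le>a. real (a choose n) * real (b choose n) * h n)"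
    by (rule sum.mono_neutral_right) (auto simp: M_def binomial_eq_0)
  finally show ?thesis by (simp add: h_def)
qed

section \<open>Moments of products of binomial coefficients\<close>

text \<open>For \<open>m > 0\<close> this is the integral over [0,1] of x^(m-1) times the polynomial
  with coefficients \<open>(a choose n) (b choose n)\<close>, hence a moment of that
  polynomial.\<close>

definition binom_moment :: "nat \<Rightarrow> nat \<Rightarrow> nat \<Rightarrow> real" where
  "binom_moment a b m = (\<Sum>n\<le>a. real (a choose n) * real (b choose n) / real (m + n))"

lemma sum_choose_mult_choose: "(\<Sum>n\<le>a. (a choose n) * (b choose n)) = (a + b) choose a"
proof -
  have "(\<Sum>n\<le>a. (a choose n) * (b choose n)) = (\<Sum>n\<le>a. (b choose n) * (a choose (a - n)))"
    by (intro sum.cong refl) (simp add: binomial_symmetric[symmetric])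
  then show ?thesis by (simp add: vandermonde add.commute)
qed

text \<open>Divide \<open>(m + a + 1) (m + b + 1)\<close> by \<open>m + n + 1\<close>, with
  remainder \<open>(a - n) (b - n)\<close>, and \<open>m^2\<close> by \<open>m + n\<close>, with
  remainder \<open>n^2\<close>. The ratio of consecutive \<open>t n\<close> makes the two fractional
  parts agree after an index shift; the polynomial parts differ by \<open>a + b + 1\<close>, and
  Vandermonde's identity sums the \<open>t n\<close>.\<close>

lemma binom_moment_Suc:
  "real (m + Suc a) * real (m + Suc b) * binom_moment a b (Suc m) =
    (real m)\<^sup>2 * binom_moment a b m + fact (Suc (a + b)) / (fact a * fact b)"
proof -
  define t where "t n = real (a choose n) * real (b choose n)" for n
  have t_Suc: "(real a - real n) * (real b - real n) * t n = (real (Suc n))\<^sup>2 * t (Suc n)" for n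
  proof -
    have "(real c - real n) * real (c choose n) = real (Suc n) * real (c choose Suc n)" for c
    proof (cases "n \<le> c")
      case True
      then show ?thesis using Suc_times_choose_Suc by (metis of_nat_diff of_nat_mult)
    qed (simp add: binomial_eq_0)
    from this[of a] this[of b] show ?thesis
      unfolding t_def power2_eq_square by (metis (no_types, opaque_lifting) mult.assoc mult.left_commute)
  qed
  have div: "P * (c / w) = c * q + e * c / w" if "P = w * q + e" "w \<noteq> 0" for P w q e c :: real
    using that by (simp add: field_simps)
  have l: "real (m + Suc a) * real (m + Suc b) * (t n / real (Suc m + n)) =
      t n * (real m + real a + real b + 1 - real n) + (real (Suc n))\<^sup>2 * t (Suc n) / real (m + Suc n)" for n
  proof -
    have "real (m + Suc a) * real (m + Suc b) =
        real (m + Suc n) * (real m + real a + real b + 1 - real n) + (real a - real n) * (real b - real n)"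
      by (simp add: algebra_simps)
    then have "real (m + Suc a) * real (m + Suc b) * (t n / real (m + Suc n)) =
        t n * (real m + real a + real b + 1 - real n) + (real a - real n) * (real b - real n) * t n / real (m + Suc n)"
      by (rule div) simp
    then show ?thesis by (simp only: t_Suc add_Suc_right add_Suc)
  qed
  have r: "(real m)\<^sup>2 * (t n / real (m + n)) = t n * (real m - real n) + (real n)\<^sup>2 * t n / real (m + n)" for n
  \<comment> \<open>Division by 0 yields 0, so both sides vanish here. The recurrence thus holds at
    \<open>m = 0\<close> too, where it supplies the moment at 1.\<close>
  proof (cases "m + n = 0")
    case False
    have "(real m)\<^sup>2 = real (m + n) * (real m - real n) + (real n)\<^sup>2"
      by (simp add: algebra_simps power2_eq_square)
    then show ?thesis by (rule div) (use False in \<open>simp del: of_nat_add\<close>)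
  qed simp
  have shift: "(\<Sum>n\<le>a. (real (Suc n))\<^sup>2 * t (Suc n) / real (m + Suc n)) = (\<Sum>n\<le>a. (real n)\<^sup>2 * t n / real (m + n))"
  proof -
    have "(\<Sum>n\<le>Suc a. (real n)\<^sup>2 * t n / real (m + n)) = (\<Sum>n\<le>a. (real (Suc n))\<^sup>2 * t (Suc n) / real (m + Suc n))"
      by (subst sum.atMost_Suc_shift) simp
    moreover have "t (Suc a) = 0" by (simp add: t_def binomial_eq_0)
    ultimately show ?thesis by simp
  qed
  have "real (m + Suc a) * real (m + Suc b) * binom_moment a b (Suc m) - (real m)\<^sup>2 * binom_moment a b m =
      (\<Sum>n\<le>a. t n * (real m + real a + real b + 1 - real n)) - (\<Sum>n\<le>a. t n * (real m - real n))"
    unfolding binom_moment_def t_def[symmetric] sum_distrib_left l r sum.distrib shift by simp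
  also have "\<dots> = (\<Sum>n\<le>a. t n) * real (Suc (a + b))"
    unfolding sum_subtractf[symmetric] sum_distrib_right by (intro sum.cong refl) (simp add: algebra_simps)
  also have "(\<Sum>n\<le>a. t n) = real ((a + b) choose a)"
    unfolding t_def sum_choose_mult_choose[symmetric] by simp
  also have "\<dots> * real (Suc (a + b)) = fact (Suc (a + b)) / (fact a * fact b)"
    by (simp add: binomial_fact)
  finally show ?thesis by simp
qed

text \<open>With \<open>i = Suc a\<close> and \<open>j = Suc b\<close> the factors of the term are
  \<open>(i + l) (j + l)\<close>, so the numerator is a product of two rising factorials, here
  written as quotients of factorials.\<close>

lemma poly_gauss_term_prod:
  "(fact k)\<^sup>2 * (fact a * fact b) * poly (gauss_term (Suc a + Suc b) k) (real (Suc a) * real (Suc b)) =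
    fact (a + k) * fact (b + k)"
proof (induction k)
  case 0
  show ?case by (simp add: gauss_term_def)
next
  case (Suc k)
  let ?u = "\<lambda>k. poly (gauss_term (Suc a + Suc b) k) (real (Suc a) * real (Suc b))"
  have "(fact (Suc k))\<^sup>2 * (fact a * fact b) * ?u (Suc k) =
      (fact k)\<^sup>2 * (fact a * fact b) * ((real (Suc k))\<^sup>2 * ?u (Suc k))"
    by (simp only: fact_Suc power_mult_distrib ac_simps)
  also have "\<dots> = (fact k)\<^sup>2 * (fact a * fact b) * ?u k * (real (Suc a) * real (Suc b) + real k * (real (Suc a + Suc b) + real k))"
    by (simp only: poly_gauss_term_Suc ac_simps)
  also have "real (Suc a) * real (Suc b) + real k * (real (Suc a + Suc b) + real k) = real (Suc (a + k)) * real (Suc (b + k))"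
    by (simp add: algebra_simps)
  also have "(fact k)\<^sup>2 * (fact a * fact b) * ?u k = fact (a + k) * fact (b + k)" by (rule Suc.IH)
  finally show ?case unfolding add_Suc_right fact_Suc by (simp only: ac_simps)
qed

text \<open>The factorial prefactor solves the homogeneous part of the recurrence for the moments;
  after division by it the inhomogeneous term is exactly the next term of Gauss's series.\<close>

lemma binom_moment_eq_gauss_sum:
  "binom_moment a b (Suc n) = (fact n)\<^sup>2 * fact (Suc (a + b)) / (fact (n + Suc a) * fact (n + Suc b)) *
    poly (gauss_sum (Suc a + Suc b) n) (real (Suc a) * real (Suc b))"
proof (induction n)
  case 0
  have aux: "f = K / (X * A * (Y * B))" if "X * Y * f = K / (A * B)" "X \<noteq> 0" "Y \<noteq> 0" "A \<noteq> 0" "B \<noteq> 0"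
    for f K X Y A B :: real
    using that by (simp add: field_simps)
  have "real (Suc a) * real (Suc b) * binom_moment a b (Suc 0) = fact (Suc (a + b)) / (fact a * fact b)"
    using binom_moment_Suc[of 0 a b] by simp
  then have "binom_moment a b (Suc 0) = fact (Suc (a + b)) / (real (Suc a) * fact a * (real (Suc b) * fact b))"
    by (rule aux) simp_all
  then show ?case by (simp add: gauss_sum_def gauss_term_def)
next
  case (Suc n)
  let ?s = "real (Suc a) * real (Suc b)" and ?d = "Suc a + Suc b"
  let ?K = "fact (Suc (a + b)) :: real" and ?f = "binom_moment a b"
  let ?D = "fact (n + Suc a) * fact (n + Suc b) :: real"
  have c: "(fact (Suc n))\<^sup>2 = (real (Suc n))\<^sup>2 * (fact n)\<^sup>2"
    by (simp only: fact_Suc power_mult_distrib)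
  have "real (Suc n + Suc a) * real (Suc n + Suc b) * ?f (Suc (Suc n)) =
      (real (Suc n))\<^sup>2 * ?f (Suc n) + ?K / (fact a * fact b)"
    by (rule binom_moment_Suc)
  also have "(real (Suc n))\<^sup>2 * ?f (Suc n) = (fact (Suc n))\<^sup>2 * ?K / ?D * poly (gauss_sum ?d n) ?s"
    unfolding Suc.IH c by (simp only: times_divide_eq_left times_divide_eq_right ac_simps)
  also have "?K / (fact a * fact b) = (fact (Suc n))\<^sup>2 * ?K / ?D * poly (gauss_term ?d (Suc n)) ?s"
  proof -
    have "(fact (Suc n))\<^sup>2 * (fact a * fact b) * poly (gauss_term ?d (Suc n)) ?s = ?D"
      using poly_gauss_term_prod[of "Suc n" a b] by (simp only: add_Suc_right add_Suc add.commute)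
    moreover have "?D \<noteq> 0" "fact a * fact b \<noteq> (0::real)" by simp_all
    moreover have "K / c = F * K / D * u" if "F * c * u = D" "D \<noteq> 0" "c \<noteq> 0" for F c u D K :: real
    proof -
      have "K * D = (F * K * u) * c" by (simp flip: that(1) add: ac_simps)
      then show ?thesis using that(2,3) by (simp add: frac_eq_eq)
    qed
    ultimately show ?thesis by blast
  qed
  finally have "real (Suc n + Suc a) * real (Suc n + Suc b) * ?f (Suc (Suc n)) =
      (fact (Suc n))\<^sup>2 * ?K / ?D * poly (gauss_sum ?d (Suc n)) ?s"
    unfolding gauss_sum_Suc poly_add by (simp only: distrib_left)
  moreover have "fact (Suc n + Suc a) * fact (Suc n + Suc b) = real (Suc n + Suc a) * real (Suc n + Suc b) * ?D"
    unfolding add_Suc fact_Suc by (simp only: ac_simps)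
  moreover have "real (Suc n + Suc a) * real (Suc n + Suc b) \<noteq> 0" by simp
  moreover have "f = c / E * S" if "p * f = c / D * S" "E = p * D" "p \<noteq> 0" for p f c D S E :: real
  proof -
    have "f = (c / D * S) / p" unfolding that(1)[symmetric] using that(3) by simp
    then show ?thesis using that(2) by (simp add: ac_simps)
  qed
  ultimately show ?case by blast
qed

text \<open>Abel summation with \<open>g n = 1 / (m + n)\<close>, which lowers both row indices by
  one.\<close>

lemma z_coeff_eq_binom_moment:
  "z_coeff m (Suc a) (Suc b) = fact (m + Suc a + Suc b) / (fact (m - 1) * fact (Suc a) * fact (Suc b)) *
    (binom_moment a b m - binom_moment a b (Suc m))"
proof -
  have "(\<Sum>k\<le>Suc a. \<Sum>l\<le>Suc b. (-1) ^ (k + l) * real (Suc a choose k) * real (Suc b choose l) / real (m + max k l)) =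
      (\<Sum>n\<le>a. real (a choose n) * real (b choose n) * (1 / real (m + n) - 1 / real (m + Suc n)))"
    using alternating_sum_max[of a b "\<lambda>n. 1 / real (m + n)"] by simp
  also have "\<dots> = binom_moment a b m - binom_moment a b (Suc m)"
    unfolding binom_moment_def sum_subtractf[symmetric] by (intro sum.cong refl) (simp add: right_diff_distrib)
  finally show ?thesis unfolding z_coeff_def by simp
qed

text \<open>The factor with \<open>l = 0\<close> kills every term but the first, so each of the
  \<open>m\<close> inner sums is 1 at 0. This settles the boundary coefficients and shows that the
  polynomial is nonzero.\<close>

lemma poly_gauss_double_sum_0: "poly (gauss_double_sum d m) 0 = real m"
proof -
  have "poly (gauss_term d k) 0 = (if k = 0 then 1 else 0)" for k
    by (cases k) (auto simp: poly_gauss_term prod.lessThan_Suc_shift simp del: prod.lessThan_Suc)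
  then show ?thesis by (simp add: gauss_double_sum_def gauss_sum_def poly_sum)
qed

lemma z_coeff_eq_gauss_double_sum:
  assumes "0 < m"
  shows "z_coeff m i j = fact (m - 1) * fact (i + j) / fact (m + i + j) *
    (poly (gauss_double_sum (i + j) m) (real i * real j) *
      (real ((m + i + j) choose i) * real ((m + i + j) choose j)))"
proof -
  have choose: "real ((m + i + j) choose i) * real ((m + i + j) choose j) =
      (fact (m + i + j))\<^sup>2 / (fact i * fact j * fact (m + i) * fact (m + j))"
    by (simp add: binomial_fact power2_eq_square add.assoc[symmetric])
  have m: "fact m = real m * fact (m - 1)" using assms by (simp add: fact_reduce)
  show ?thesis
  proof (cases "i = 0 \<or> j = 0")
    case True
    then show ?thesis
      unfolding choose using assms
      by (auto simp: z_coeff_0_left z_coeff_0_right poly_gauss_double_sum_0 m power2_eq_square)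
  next
    case False
    then obtain a b where ij: "i = Suc a" "j = Suc b" by (metis not0_implies_Suc)
    obtain n where n: "m = Suc n" using assms by (metis not0_implies_Suc less_irrefl)
    let ?s = "real i * real j" and ?d = "i + j"
    let ?S = "\<lambda>n. poly (gauss_sum ?d n) ?s" and ?K = "fact (Suc (a + b)) :: real"
    let ?D = "fact (m + i) * fact (m + j) :: real"
    have D: "?D = real (m + i) * real (m + j) * (fact (n + i) * fact (n + j))"
      unfolding n add_Suc fact_Suc by (simp only: ac_simps)
    have 1: "binom_moment a b m = (fact n)\<^sup>2 * ?K / ?D * (real (m + i) * real (m + j) * ?S n)"
      unfolding n using binom_moment_eq_gauss_sum[of a b n] D[unfolded n] unfolding ij
      by (simp del: fact_Suc of_nat_add of_nat_Suc)
    have 2: "binom_moment a b (Suc m) = (fact n)\<^sup>2 * ?K / ?D * ((real m)\<^sup>2 * ?S m)"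
    proof -
      have "(fact m)\<^sup>2 = (real m)\<^sup>2 * (fact n :: real)\<^sup>2"
        unfolding n by (simp only: fact_Suc power_mult_distrib)
      then show ?thesis using binom_moment_eq_gauss_sum[of a b m] unfolding ij
        by (simp only: times_divide_eq_left times_divide_eq_right ac_simps)
    qed
    have "binom_moment a b m - binom_moment a b (Suc m) =
        (fact n)\<^sup>2 * ?K / ?D * (real (m + i) * real (m + j) * ?S n - (real m)\<^sup>2 * ?S m)"
      unfolding 1 2 by (simp only: right_diff_distrib)
    \<comment> \<open>Since \<open>(m + i) (m + j) = m^2 + m d + s\<close> and
      \<open>n = m - 1\<close>, the squares combine into the single term with index
      \<open>m\<close>, the shape of \<open>gauss_double_sum_eq\<close>.\<close>
    also have "real (m + i) * real (m + j) * ?S n - (real m)\<^sup>2 * ?S m =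
        (real m * real ?d + ?s) * ?S n - (real m)\<^sup>2 * poly (gauss_term ?d m) ?s"
      unfolding n gauss_sum_Suc poly_add by (simp add: algebra_simps power2_eq_square)
    also have "\<dots> = real ?d * poly (gauss_double_sum ?d m) ?s"
      unfolding n gauss_double_sum_eq ..
    finally have "binom_moment a b m - binom_moment a b (Suc m) =
        (fact n)\<^sup>2 * (real ?d * ?K) / ?D * poly (gauss_double_sum ?d m) ?s"
      by (simp add: ac_simps)
    also have "real ?d * ?K = fact ?d" unfolding ij by (simp add: algebra_simps)
    finally have "z_coeff m i j = fact (m + i + j) / (fact n * fact i * fact j) *
        ((fact n)\<^sup>2 * fact ?d / ?D * poly (gauss_double_sum ?d m) ?s)"
      using z_coeff_eq_binom_moment[of m a b] unfolding ij n by simp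
    moreover have "N / (f * u * v) * (f\<^sup>2 * e / (x * y) * r) = f * e / N * (r * (N\<^sup>2 / (u * v * x * y)))"
      if "N \<noteq> 0" "f \<noteq> 0" for N f u v e x y r :: real
      using that by (simp add: power2_eq_square ac_simps)
    moreover have "m - 1 = n" by (simp add: n)
    ultimately show ?thesis unfolding choose by simp
  qed
qed

section \<open>Polynomials with only negative zeros\<close>

definition neg_rooted :: "complex poly \<Rightarrow> bool" where
  "neg_rooted p \<longleftrightarrow> p \<noteq> 0 \<and> (\<forall>z. poly p z = 0 \<longrightarrow> z \<in> \<real> \<and> Re z < 0)"

text \<open>The partial fractions of the logarithmic derivative, by the product rule over the linear
  factors; \<open>A\<close> is the multiset of zeros with multiplicity.\<close>

lemma log_derivative:
  fixes p :: "'a::alg_closed_field poly"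
  assumes "p \<noteq> 0"
  obtains A where "size A = degree p" "\<And>a. a \<in># A \<Longrightarrow> poly p a = 0"
    "\<And>z. poly p z \<noteq> 0 \<Longrightarrow> poly (pderiv p) z = poly p z * (\<Sum>a\<in>#A. 1 / (z - a))"
proof -
  obtain A where A: "size A = degree p" "p = smult (lead_coeff p) (\<Prod>x\<in>#A. [:-x, 1:])"
    using alg_closed_imp_factorization[OF assms] by blast
  define q where "q A = (\<Prod>x\<in>#A. [:-x, 1:])" for A :: "'a multiset"
  have root: "poly (q A) a = 0" if "a \<in># A" for a A
    using that by (induction A) (auto simp: q_def)
  have "poly (pderiv (q A)) z = poly (q A) z * (\<Sum>a\<in>#A. 1 / (z - a))" if "poly (q A) z \<noteq> 0" for z
    using that
  proof (induction A)
    case (add a A)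
    have q: "q (add_mset a A) = [:- a, 1:] * q A" by (simp add: q_def)
    then have "z \<noteq> a" "poly (q A) z \<noteq> 0" using add.prems by auto
    then show ?case
      using add.IH unfolding q pderiv_mult by (simp add: pderiv_pCons field_simps)
  qed (simp add: q_def)
  then have "poly (pderiv p) z = poly p z * (\<Sum>a\<in>#A. 1 / (z - a))" if "poly p z \<noteq> 0" for z
    using that by (subst (1 2) A(2), subst (asm) A(2)) (simp add: pderiv_smult flip: q_def)
  moreover have "poly p a = 0" if "a \<in># A" for a
    by (subst A(2)) (use root[OF that] in \<open>simp flip: q_def\<close>)
  ultimately show ?thesis using that[of A] A(1) by blast
qed

lemma Im_sum_mset: "Im (\<Sum>a\<in>#A. f a) = (\<Sum>a\<in>#A. Im (f a))"
  by (induction A) auto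

lemma Re_sum_mset: "Re (\<Sum>a\<in>#A. f a) = (\<Sum>a\<in>#A. Re (f a))"
  by (induction A) auto

lemma sum_mset_nonneg_real: "(\<And>a. a \<in># A \<Longrightarrow> 0 \<le> f a) \<Longrightarrow> (0::real) \<le> (\<Sum>a\<in>#A. f a)"
  by (induction A) auto

lemma sum_mset_eq_0_imp_empty:
  fixes f :: "'a \<Rightarrow> real"
  assumes "\<And>a. a \<in># A \<Longrightarrow> 0 < f a" "(\<Sum>a\<in>#A. f a) = 0"
  shows "A = {#}"
proof (cases A)
  case (add a B)
  then have "0 < f a" using assms(1) by simp
  moreover have "0 \<le> (\<Sum>a\<in>#B. f a)"
    using assms(1) add by (intro sum_mset_nonneg_real) (simp add: less_imp_le)
  ultimately show ?thesis using assms(2) add by simp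
qed simp

text \<open>For real \<open>a < 0\<close> the imaginary part of \<open>z / (z - a)\<close> is a
  positive multiple of that of \<open>z\<close>, so nothing can cancel in the sum.\<close>

lemma real_if_real_log_derivative:
  fixes z :: complex
  assumes "\<And>a. a \<in># A \<Longrightarrow> a \<in> \<real>" "\<And>a. a \<in># A \<Longrightarrow> Re a < 0"
    and "Im (z * (\<Sum>a\<in>#A. 1 / (z - a))) = 0" "A \<noteq> {#}"
  shows "z \<in> \<real>"
proof (rule ccontr)
  assume "z \<notin> \<real>"
  then have Im: "Im z \<noteq> 0" by (simp add: complex_is_Real_iff)
  define g where "g a = - Re a / (cmod (z - a))\<^sup>2" for a
  have "Im (z / (z - a)) = Im z * g a" if "a \<in># A" for a
    using assms(1)[OF that] unfolding g_def cmod_power2 Im_divide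
    by (simp add: complex_is_Real_iff algebra_simps)
  then have "Im (z * (\<Sum>a\<in>#A. 1 / (z - a))) = (\<Sum>a\<in>#A. Im z * g a)"
    unfolding sum_mset_distrib_left Im_sum_mset by (intro arg_cong[where f = sum_mset] image_mset_cong) simp
  then have "Im z * (\<Sum>a\<in>#A. g a) = 0"
    using assms(3) by (simp add: sum_mset_distrib_left)
  then have "(\<Sum>a\<in>#A. g a) = 0" using Im by simp
  moreover have "0 < g a" if "a \<in># A" for a
    using assms(1,2)[OF that] Im unfolding g_def
    by (intro divide_pos_pos) (auto simp: complex_is_Real_iff)
  ultimately show False using sum_mset_eq_0_imp_empty[of A g] assms(4) by blast
qed

text \<open>The operator is t d/dt - x. At a zero that is not one of \<open>f\<close>, the sum of
  \<open>z / (z - a)\<close> equals the real number \<open>x\<close>, so \<open>z\<close> is real.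
  If \<open>z >= 0\<close>, each summand lies in [0,1], which places \<open>x\<close> between 0 and
  the degree.\<close>

lemma neg_rooted_theta:
  assumes "neg_rooted f" "degree f \<le> d" "x < 0 \<or> real d < x"
  shows "neg_rooted (pCons 0 (pderiv f) - smult (of_real x) f)"
proof -
  let ?g = "pCons 0 (pderiv f) - smult (of_real x) f"
  have f: "f \<noteq> 0" "\<And>z. poly f z = 0 \<Longrightarrow> z \<in> \<real> \<and> Re z < 0"
    using assms(1) by (auto simp: neg_rooted_def)
  obtain A where A: "size A = degree f" "\<And>a. a \<in># A \<Longrightarrow> poly f a = 0"
    "\<And>z. poly f z \<noteq> 0 \<Longrightarrow> poly (pderiv f) z = poly f z * (\<Sum>a\<in>#A. 1 / (z - a))"
    using log_derivative[OF f(1)] by blast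
  have neg: "a \<in> \<real>" "Re a < 0" if "a \<in># A" for a using A(2) f(2) that by auto
  have z: "z \<in> \<real> \<and> Re z < 0" if z: "poly ?g z = 0" for z
  proof (cases "poly f z = 0")
    case False
    have "z * poly (pderiv f) z = of_real x * poly f z"
      using z by simp
    then have eq: "z * (\<Sum>a\<in>#A. 1 / (z - a)) = of_real x"
      using A(3)[OF False] False by simp
    have "A \<noteq> {#}" using eq assms(3) by auto
    moreover have "Im (z * (\<Sum>a\<in>#A. 1 / (z - a))) = 0" unfolding eq by simp
    ultimately have real: "z \<in> \<real>" using real_if_real_log_derivative[of A z] neg by blast
    have "Re z < 0"
    proof (rule ccontr)
      assume "\<not> Re z < 0"
      then have z0: "0 \<le> Re z" by simp
      have b: "0 \<le> Re (z * (1 / (z - a))) \<and> Re (z * (1 / (z - a))) \<le> 1" if "a \<in># A" for a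
        using neg[OF that] z0 real by (elim Reals_cases) (auto simp: field_simps)
      have "x = (\<Sum>a\<in>#A. Re (z * (1 / (z - a))))"
        using arg_cong[OF eq, of Re] unfolding sum_mset_distrib_left Re_sum_mset by simp
      moreover have "0 \<le> (\<Sum>a\<in>#A. Re (z * (1 / (z - a))))"
        using b by (intro sum_mset_nonneg_real) auto
      moreover have "(\<Sum>a\<in>#A. Re (z * (1 / (z - a)))) \<le> (\<Sum>a\<in>#A. 1)"
        using b by (intro sum_mset_mono) auto
      ultimately show False using assms(2,3) A(1) by simp
    qed
    then show ?thesis using real by simp
  qed (use f(2) in blast)
  \<comment> \<open>The zero polynomial would vanish at 0, which is not negative.\<close>
  moreover have "?g \<noteq> 0"
  proof
    assume "?g = 0"
    then show False using z[of 0] by simp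
  qed
  ultimately show ?thesis by (simp add: neg_rooted_def)
qed

lemma coeff_theta:
  fixes f :: "'a::idom poly"
  shows "coeff (pCons 0 (pderiv f) - smult c f) i = (of_nat i - c) * coeff f i"
  by (cases i) (auto simp: coeff_pderiv algebra_simps)

text \<open>With \<open>\<beta> = x (d + x)\<close> the multiplier is
  \<open>(i + x) (d - i + x)\<close>. Up to sign it comes from applying t d/dt - y for
  \<open>y = - x\<close> and for \<open>y = d + x\<close>, both outside [0,d].\<close>

lemma neg_rooted_quadratic_multiplier:
  assumes "neg_rooted (\<Sum>i\<le>d. monom (of_real (a i)) i)" "0 < \<beta>"
  shows "neg_rooted (\<Sum>i\<le>d. monom (of_real ((real i * real (d - i) + \<beta>) * a i)) i)"
proof -
  \<comment> \<open>The positive solution of \<open>x (d + x) = \<beta>\<close>.\<close>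
  define x where "x = (sqrt ((real d)\<^sup>2 + 4 * \<beta>) - real d) / 2"
  have "real d < sqrt ((real d)\<^sup>2 + 4 * \<beta>)" using assms(2) by (intro real_less_rsqrt) simp
  then have x: "0 < x" by (simp add: x_def)
  have "2 * x + real d = sqrt ((real d)\<^sup>2 + 4 * \<beta>)" by (simp add: x_def field_simps)
  then have "(2 * x + real d)\<^sup>2 = (real d)\<^sup>2 + 4 * \<beta>" using assms(2) by simp
  then have \<beta>: "\<beta> = x * (real d + x)" by (simp add: power2_eq_square algebra_simps)
  let ?f = "\<Sum>i\<le>d. monom (of_real (a i)) i :: complex poly"
  define T where "T y f = pCons 0 (pderiv f) - smult (complex_of_real y) f" for y f
  have cT: "coeff (T y f) i = (of_nat i - of_real y) * coeff f i" for y f i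
    unfolding T_def by (rule coeff_theta)
  have cf: "coeff ?f i = (if i \<le> d then of_real (a i) else 0)" for i
    by (simp add: coeff_sum)
  have T: "neg_rooted (T y f)" if "neg_rooted f" "\<And>i. d < i \<Longrightarrow> coeff f i = 0" "y < 0 \<or> real d < y" for y f
    unfolding T_def using that by (intro neg_rooted_theta[of _ d] degree_le) auto
  have "neg_rooted (T (- x) ?f)"
    using x cf by (intro T assms(1)) auto
  then have "neg_rooted (T (real d + x) (T (- x) ?f))"
    using x cf cT by (intro T[of "T (- x) ?f"]) auto
  moreover have "T (real d + x) (T (- x) ?f) =
      - (\<Sum>i\<le>d. monom (of_real ((real i * real (d - i) + \<beta>) * a i)) i)"
    by (rule poly_eqI) (auto simp: cf cT coeff_sum \<beta> of_nat_diff algebra_simps)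
  ultimately show ?thesis by (simp add: neg_rooted_def)
qed

lemma neg_rooted_quadratic_multipliers:
  fixes n :: nat
  assumes "neg_rooted (\<Sum>i\<le>d. monom (of_real (a i)) i)" "\<And>b. b < n \<Longrightarrow> 0 < \<beta> b"
  shows "neg_rooted (\<Sum>i\<le>d. monom (of_real ((\<Prod>b<n. real i * real (d - i) + \<beta> b) * a i)) i)"
  using assms(2)
proof (induction n)
  case (Suc n)
  then show ?case
    using neg_rooted_quadratic_multiplier[OF Suc.IH, of "\<beta> n"] by (simp add: mult_ac)
qed (use assms(1) in simp)

section \<open>Zeros of higher derivatives and the binomial sum\<close>

text \<open>Gauss-Lucas for the segment [0,1]: at a new critical point the sum of
  \<open>1 / (z - a)\<close> vanishes, but off the real line all imaginary parts share one sign, and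
  on it outside [0,1] all real parts do.\<close>

lemma pderiv_roots_in_segment:
  fixes p :: "complex poly"
  assumes "pderiv p \<noteq> 0" "\<And>z. poly p z = 0 \<Longrightarrow> z \<in> \<real> \<and> 0 \<le> Re z \<and> Re z \<le> 1"
    and "poly (pderiv p) z = 0"
  shows "z \<in> \<real> \<and> 0 \<le> Re z \<and> Re z \<le> 1"
proof (cases "poly p z = 0")
  case False
  have "p \<noteq> 0" using assms(1) by auto
  then obtain A where A: "size A = degree p" "\<And>a. a \<in># A \<Longrightarrow> poly p a = 0"
    "\<And>z. poly p z \<noteq> 0 \<Longrightarrow> poly (pderiv p) z = poly p z * (\<Sum>a\<in>#A. 1 / (z - a))"
    using log_derivative by blast
  have ne: "A \<noteq> {#}" using assms(1) A(1) by (auto simp: pderiv_eq_0_iff)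
  have sum: "(\<Sum>a\<in>#A. 1 / (z - a)) = 0" using A(3)[OF False] assms(3) False by simp
  have a: "a \<in> \<real>" "0 \<le> Re a" "Re a \<le> 1" "z \<noteq> a" if "a \<in># A" for a
    using A(2)[OF that] assms(2) False by auto
  have real: "z \<in> \<real>"
  proof (rule ccontr)
    assume "z \<notin> \<real>"
    then have Im: "Im z \<noteq> 0" by (simp add: complex_is_Real_iff)
    have "(\<Sum>a\<in>#A. Im (1 / (z - a))) = (\<Sum>a\<in>#A. - Im z * (1 / (cmod (z - a))\<^sup>2))"
      using a(1) by (intro arg_cong[where f = sum_mset] image_mset_cong)
        (auto simp: Im_divide cmod_power2 complex_is_Real_iff)
    then have "- Im z * (\<Sum>a\<in>#A. 1 / (cmod (z - a))\<^sup>2) = 0"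
      using arg_cong[OF sum, of Im] unfolding Im_sum_mset sum_mset_distrib_left by simp
    then have "(\<Sum>a\<in>#A. 1 / (cmod (z - a))\<^sup>2) = 0" using Im by simp
    moreover have "0 < 1 / (cmod (z - a))\<^sup>2" if "a \<in># A" for a using a(4)[OF that] by simp
    ultimately show False using sum_mset_eq_0_imp_empty[of A "\<lambda>a. 1 / (cmod (z - a))\<^sup>2"] ne by blast
  qed
  have Re: "(\<Sum>a\<in>#A. Re (1 / (z - a))) = 0" using arg_cong[OF sum, of Re] by (simp add: Re_sum_mset)
  have r: "Re (1 / (z - a)) = 1 / (Re z - Re a)" if "a \<in># A" for a
    using real a(1)[OF that] by (elim Reals_cases) auto
  have "0 \<le> Re z"
  proof (rule ccontr)
    assume "\<not> 0 \<le> Re z"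
    then have "0 < - Re (1 / (z - a))" if "a \<in># A" for a
      using a[OF that] r[OF that] by (simp add: divide_less_0_iff)
    moreover have "(\<Sum>a\<in>#A. - Re (1 / (z - a))) = 0"
      using Re sum_mset_distrib_left[of "- 1" "\<lambda>a. Re (1 / (z - a))" A] by simp
    ultimately show False using sum_mset_eq_0_imp_empty[of A "\<lambda>a. - Re (1 / (z - a))"] ne by blast
  qed
  moreover have "Re z \<le> 1"
  proof (rule ccontr)
    assume "\<not> Re z \<le> 1"
    then have "0 < Re (1 / (z - a))" if "a \<in># A" for a
      using a[OF that] r[OF that] by simp
    then show False using sum_mset_eq_0_imp_empty[of A "\<lambda>a. Re (1 / (z - a))"] ne Re by blast
  qed
  ultimately show ?thesis using real by simp
qed (use assms(2) in blast)

lemma higher_pderiv_mult: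
  fixes p q :: "'a::idom poly"
  shows "(pderiv ^^ n) (p * q) =
    (\<Sum>i\<le>n. of_nat (n choose i) * ((pderiv ^^ i) p * (pderiv ^^ (n - i)) q))"
proof (induction n)
  case (Suc n)
  let ?D = "\<lambda>k. pderiv ^^ k"
  let ?t = "\<lambda>i. ?D i p * ?D (Suc n - i) q"
  have "?D (Suc n) (p * q) = pderiv (\<Sum>i\<le>n. of_nat (n choose i) * (?D i p * ?D (n - i) q))"
    by (simp add: Suc.IH)
  also have "\<dots> = (\<Sum>i\<le>n. of_nat (n choose i) * ?t (Suc i) + of_nat (n choose i) * ?t i)"
    unfolding higher_pderiv_sum[of 1, simplified]
  proof (rule sum.cong[OF refl])
    fix i assume "i \<in> {..n}"
    then have "Suc n - i = Suc (n - i)" by simp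
    then show "pderiv (of_nat (n choose i) * (?D i p * ?D (n - i) q)) =
        of_nat (n choose i) * ?t (Suc i) + of_nat (n choose i) * ?t i"
      by (simp add: pderiv_mult algebra_simps)
  qed
  also have "\<dots> = (\<Sum>i\<le>n. of_nat (n choose i) * ?t (Suc i)) + (\<Sum>i\<le>Suc n. of_nat (n choose i) * ?t i)"
    by (simp add: sum.distrib binomial_eq_0)
  also have "\<dots> = ?t 0 + (\<Sum>i\<le>n. of_nat (Suc n choose Suc i) * ?t (Suc i))"
    by (subst sum.atMost_Suc_shift) (simp add: sum.distrib[symmetric] algebra_simps)
  also have "\<dots> = (\<Sum>i\<le>Suc n. of_nat (Suc n choose i) * ?t i)"
    by (subst sum.atMost_Suc_shift) simp
  finally show ?case .
qed simp

lemma higher_pderiv_linear_power: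
  fixes a :: "'a::{idom,semiring_char_0}"
  assumes "i \<le> n"
  shows "(pderiv ^^ i) ([:a, 1:] ^ n) = of_nat (fact i * (n choose i)) * [:a, 1:] ^ (n - i)"
  using assms
proof (induction i)
  case (Suc i)
  then obtain k where k: "n - i = Suc k" "n - Suc i = k" by (metis Suc_diff_Suc Suc_le_lessD)
  have "fact i * (n choose i) * Suc k = fact (Suc i) * (n choose Suc i)"
    using Suc_times_choose_Suc[of i n] unfolding k(1)
    by (simp only: fact_Suc of_nat_id mult.assoc mult.left_commute[of "Suc i"]) (simp only: ac_simps)
  moreover have "pderiv ([:a, 1:] ^ Suc k) = of_nat (Suc k) * [:a, 1:] ^ k"
    by (subst pderiv_power_Suc) (simp add: pderiv_pCons of_nat_poly)
  ultimately have "pderiv (of_nat (fact i * (n choose i)) * [:a, 1:] ^ Suc k) =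
      of_nat (fact (Suc i) * (n choose Suc i)) * [:a, 1:] ^ k"
    by (simp only: pderiv_mult pderiv_of_nat mult_zero_left mult_zero_right add_0_left add_0_right
        mult.assoc[symmetric] of_nat_mult[symmetric])
  then show ?case using Suc k by simp
qed simp

text \<open>A Rodrigues formula: under \<open>t = x / (x - 1)\<close> the polynomial becomes, up to powers of \<open>x\<close> and \<open>x - 1\<close>,
  the \<open>d\<close>-th derivative of \<open>(x - 1)\<^sup>N x\<^sup>N\<close>.\<close>

lemma neg_rooted_binomial_product:
  assumes "1 \<le> d"
  shows "neg_rooted (\<Sum>i\<le>d. monom (of_real (real ((m + d) choose i) * real ((m + d) choose (d - i)))) i)"
proof -
  define N where "N = m + d"
  define c where "c i = real (N choose i) * real (N choose (d - i))" for i
  let ?B = "\<Sum>i\<le>d. monom (of_real (c i)) i :: complex poly"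
  have B: "poly ?B t = (\<Sum>i\<le>d. of_real (c i) * t ^ i)" for t
    by (simp add: poly_sum poly_monom)
  define p :: "complex poly" where "p = [:-1, 1:] ^ N * [:0, 1:] ^ N"
  have N: "1 \<le> N" "d \<le> N" using assms by (auto simp: N_def)
  have deg_p: "degree p = 2 * N"
    unfolding p_def by (subst degree_mult_eq) (auto simp: degree_linear_power)
  \<comment> \<open>Iterates Gauss-Lucas from the zeros 0 and 1 of \<open>p\<close>; no derivative
    up to order \<open>d\<close> is zero, because \<open>p\<close> has degree
    \<open>2 * N > d\<close>.\<close>
  have seg: "poly ((pderiv ^^ k) p) z = 0 \<Longrightarrow> z \<in> \<real> \<and> 0 \<le> Re z \<and> Re z \<le> 1" if "k \<le> d" for k z
    using that
  proof (induction k arbitrary: z)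
    case 0
    then have "z = 0 \<or> z = 1" by (auto simp: p_def)
    then show ?case by auto
  next
    case (Suc k)
    have "degree ((pderiv ^^ Suc k) p) > 0"
      unfolding degree_higher_pderiv deg_p using Suc.prems N by simp
    then have "pderiv ((pderiv ^^ k) p) \<noteq> 0" by auto
    then show ?case using Suc pderiv_roots_in_segment[of "(pderiv ^^ k) p" z] by simp
  qed
  have rodrigues: "poly ((pderiv ^^ d) p) (t / (t - 1)) =
      fact d * (t / (t - 1) - 1) ^ (N + m) * t ^ m * poly ?B t" if t: "t \<noteq> 1" for t
  proof -
    define x where "x = t / (t - 1)"
    have x: "x = t * (x - 1)" using t by (simp add: x_def field_simps)
    have "poly ((pderiv ^^ d) p) x = (\<Sum>i\<le>d. fact d * (x - 1) ^ (N + m) * t ^ m * (of_real (c i) * t ^ i))"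
      unfolding p_def higher_pderiv_mult poly_sum
    proof (rule sum.cong[OF refl])
      fix i assume "i \<in> {..d}"
      then have i: "i \<le> d" "i \<le> N" "d - i \<le> N" "N - (d - i) = m + i" "N + m = (N - i) + (m + i)"
        using N by (auto simp: N_def)
      have "(d choose i) * fact i * fact (d - i) = (fact d :: nat)"
        using binomial_fact_lemma[OF i(1)] by (simp add: ac_simps)
      then have f: "of_nat (d choose i) * fact i * fact (d - i) = (fact d :: complex)"
        by (metis of_nat_fact of_nat_mult)
      have "poly (of_nat (d choose i) * ((pderiv ^^ i) ([:-1, 1:] ^ N) * (pderiv ^^ (d - i)) ([:0, 1:] ^ N))) x =
          (of_nat (d choose i) * fact i * fact (d - i)) * of_real (c i) * ((x - 1) ^ (N - i) * x ^ (m + i))"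
        using higher_pderiv_linear_power[OF i(2), of "-1::complex"] higher_pderiv_linear_power[OF i(3), of "0::complex"]
        by (simp add: i(4) of_nat_poly c_def)
      also have "x ^ (m + i) = t ^ (m + i) * (x - 1) ^ (m + i)"
        by (subst x) (simp add: power_mult_distrib)
      finally show "poly (of_nat (d choose i) * ((pderiv ^^ i) ([:-1, 1:] ^ N) * (pderiv ^^ (d - i)) ([:0, 1:] ^ N))) x =
          fact d * (x - 1) ^ (N + m) * t ^ m * (of_real (c i) * t ^ i)"
        unfolding f i(5) power_add by (simp only: ac_simps)
    qed
    then show ?thesis by (simp only: x_def B sum_distrib_left)
  qed
  have c0: "c 0 > 0" using N(2) by (simp add: c_def)
  then have B0: "poly ?B 0 \<noteq> 0"
    by (simp add: poly_0_coeff_0 coeff_sum)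
  \<comment> \<open>The substitution is undefined at \<open>t = 1\<close>; nonnegative coefficients,
    one of them positive, exclude this point as a zero.\<close>
  have B1: "poly ?B 1 \<noteq> 0"
  proof -
    have "0 < (\<Sum>i\<le>d. c i)"
      using c0 by (intro sum_pos2[of _ 0]) (auto simp: c_def)
    moreover have "poly ?B 1 = of_real (\<Sum>i\<le>d. c i)" unfolding B by simp
    ultimately show ?thesis by (metis less_irrefl of_real_eq_0_iff)
  qed
  have "t \<in> \<real> \<and> Re t < 0" if t: "poly ?B t = 0" for t
  proof -
    have ne: "t \<noteq> 0" "t \<noteq> 1" using t B0 B1 by auto
    have "poly ((pderiv ^^ d) p) (t / (t - 1)) = 0" using rodrigues[OF ne(2)] t by simp
    then have "t / (t - 1) \<in> \<real>" and r: "0 \<le> Re (t / (t - 1))" "Re (t / (t - 1)) \<le> 1"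
      using seg[of d] by auto
    then obtain r where x: "t / (t - 1) = of_real r" by (elim Reals_cases)
    have "r \<noteq> 1" using x ne by (auto simp: field_simps)
    then have r: "0 \<le> r" "r < 1" using r x by auto
    \<comment> \<open>The map t / (t - 1) is its own inverse and sends the open interval (0,1) to
      the negative axis.\<close>
    have "t = of_real r / (of_real r - 1)"
      using ne \<open>r \<noteq> 1\<close> unfolding x[symmetric] by (simp add: field_simps)
    then have tr: "t = of_real (r / (r - 1))" by simp
    have "r \<noteq> 0" using tr ne(1) by auto
    then show ?thesis using r unfolding tr by (simp add: divide_less_0_iff)
  qed
  moreover have "?B \<noteq> 0" using B0 by auto
  ultimately show ?thesis unfolding neg_rooted_def c_def N_def by blast
qed

theorem theorem1p7:
  fixes E :: "'a set" and m d :: nat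
  assumes "2 \<le> m" and "m \<le> 15" and "1 \<le> d"
    and "finite E" and "card E = m + d"
  shows "\<forall>z::complex. poly (map_poly of_int (z_poly (uniform_matroid E d))) z = 0 \<longrightarrow>
           z \<in> \<real> \<and> Re z < 0"
proof -
  let ?U = "uniform_matroid E d"
  let ?p = "map_poly of_int (z_poly ?U) :: complex poly"
  have m: "0 < m" using assms(1) by simp
  then obtain n where n: "m = Suc n" by (metis not0_implies_Suc less_irrefl)
  obtain c \<beta> where \<beta>: "\<And>b. b < n \<Longrightarrow> (0::real) < \<beta> b"
    and R: "gauss_double_sum d m = smult c (\<Prod>b<n. [:\<beta> b, 1:])"
    using gauss_double_sum_factorization[OF assms(3), of n] unfolding n by blast
  define K where "K = fact (m - 1) * fact d / fact (m + d) * c"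
  \<comment> \<open>The value \<open>m\<close> at 0 rules out \<open>c = 0\<close>, so the passage
    to \<open>?q\<close> loses no zeros.\<close>
  have "poly (gauss_double_sum d m) 0 \<noteq> 0"
    using m by (simp add: poly_gauss_double_sum_0)
  then have K: "K \<noteq> 0" unfolding R K_def by auto
  define a where "a i = (\<Prod>b<n. real i * real (d - i) + \<beta> b) *
    (real ((m + d) choose i) * real ((m + d) choose (d - i)))" for i
  let ?q = "\<Sum>i\<le>d. monom (of_real (a i)) i :: complex poly"
  have q: "neg_rooted ?q"
    unfolding a_def
    by (rule neg_rooted_quadratic_multipliers[OF neg_rooted_binomial_product[OF assms(3)] \<beta>])
  have U: "matroid ?U" "loopless ?U" "rk ?U = d"
    using assms matroid_uniform_matroid loopless_uniform_matroid rk_uniform_matroid[of E d] by auto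
  have "?p = smult (of_real K) ?q"
  proof (rule poly_eqI)
    fix i
    show "coeff ?p i = coeff (smult (of_real K) ?q) i"
    proof (cases "i \<le> d")
      case True
      have "real_of_int (coeff (z_poly ?U) i) = z_coeff m i (d - i)"
        by (rule coeff_z_poly_uniform_matroid[OF m assms(3-5) True])
      also have "\<dots> = fact (m - 1) * fact d / fact (m + d) * (poly (gauss_double_sum d m) (real i * real (d - i)) *
          (real ((m + d) choose i) * real ((m + d) choose (d - i))))"
        using z_coeff_eq_gauss_double_sum[OF m, of i "d - i"] True by (simp add: add.assoc)
      also have "poly (gauss_double_sum d m) (real i * real (d - i)) =
          c * (\<Prod>b<n. real i * real (d - i) + \<beta> b)"
        unfolding R by (simp add: poly_prod add.commute)
      finally have "real_of_int (coeff (z_poly ?U) i) = K * a i"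
        unfolding K_def a_def by (simp only: mult.assoc)
      then have "of_int (coeff (z_poly ?U) i) = complex_of_real (K * a i)"
        by (metis of_real_of_int_eq)
      then show ?thesis using True by (simp add: coeff_map_poly coeff_sum)
    next
      case False
      then have "coeff (z_poly ?U) i = 0"
        using degree_z_poly_le[OF U(1,2)] U(3) by (intro coeff_eq_0) simp
      then show ?thesis using False by (simp add: coeff_map_poly coeff_sum)
    qed
  qed
  then show ?thesis using q K by (simp add: neg_rooted_def)
qed

end
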